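(* Let $m\ge1$. Let $\{P_\theta:\theta\in\Theta\}$, $\Theta\subset\mathbb{R}^d$ open, satisfy the regularity condition of order $m+1$ at $\theta\in\Theta$ (see context), and let $T$ be an unbiased estimator of $\theta$ with finite second moments and covariance matrix $\Sigma=\Sigma(\theta)$. Then for every $v\in\mathbb{R}^d$, $$v^\top(\Sigma-B^{(m)})v\ \ge\ \frac{\langle Z_v,\Pi_v^{(m+1)}\rangle^2}{\|\Pi_v^{(m+1)}\|^2},$$ where the right-hand side is taken to be $0$ if $\Pi_v^{(m+1)}=0$. Equality holds if and only if the normal component $Z_v-\mathrm{Proj}_{\mathcal T_m}Z_v$ of $Z_v$ relative to $\mathcal T_m$ is collinear with (i.e. linearly dependent with) $\Pi_v^{(m+1)}$.
   Context: Setting. $(\mathcal X,\mathcal F)$ is a measurable space with a $\sigma$-finite measure $\mu$; $\{P_\theta:\theta\in\Theta\}$, $\Theta\subset\mathbb{R}^d$ open, is a family of probability measures with strictly positive densities $f(x;\theta)=dP_\theta/d\mu$. $H=L^2(\mu)$ (real) with inner product $\langle u,w\rangle=\int uw\,d\mu$ and norm $\|\cdot\|$; $\mathrm{Proj}_V$ is orthogonal projection onto a closed subspace $V\subseteq H$. The square-root embedding is $s:\Theta\to H$, $s(\theta)(x)=\sqrt{f(x;\theta)}$. For a multi-index $\alpha\in\mathbb{N}_0^d$, $|\alpha|=\sum_i\alpha_i$, $\partial^\alpha=\partial_1^{\alpha_1}\cdots\partial_d^{\alpha_d}$ (derivatives in $\theta$), and $\eta_\alpha(\theta)=\partial^\alpha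 s(\theta)$; in particular $\eta_i=\partial_i s$. Regularity of order $k$ (at $\theta$): (i) $s:\Theta\to H$ is $k$-times Fréchet differentiable, so $\eta_\alpha(\theta)\in H$ for $1\le|\alpha|\le k$ and every $\theta\in\Theta$; (ii) the partial derivatives $\partial^\alpha f(x;\theta)$ exist for $|\alpha|\le k$, and for every real-valued statistic $T$ with $\mathbb{E}_\theta[T^2]<\infty$ (for all $\theta$) one has $\partial^\alpha\int T(x)f(x;\theta)\,d\mu=\int T(x)\,\partial^\alpha f(x;\theta)\,d\mu$ for all $|\alpha|\le k$; (iii) the Gram matrix $G^{(k)}(\theta)$ with entries $\langle\eta_\alpha,\eta_\beta\rangle$, $1\le|\alpha|,|\beta|\le k$, is strictly positive definite at $\theta$. Everything below is evaluated at the fixed $\theta$. $G=(\langle\eta_i,\eta_j\rangle)_{i,j=1}^d$. The $m$-th order jet space is $\mathcal T_m=\mathrm{span}\{\eta_\alpha:1\le|\alpha|\le m\}\subset H$. Estimator. $T=(T_1,\dots,T_d):\mathcal X\to\mathbb{R}^d$ is measurable with $\mathbb{E}_\theta[T_p^2]<\infty$ and $\mathbb{E}_\theta[T]=\theta$ for all $\theta\in\Theta$; $\Sigma(\theta)_{pq}=\mathbb{E}_\theta[(T_p-\theta_p)(T_q-\theta_q)]$. The lifted errors are $\widetilde Z^{(p)}=(T_p-\theta_p)\,s(\theta)\in H$, and for $v\in\mathbb{R}^d$, $Z_v=\sum_{p}v_p\widetilde Z^{(p)}\in H$. The $m$-th order Bhattacharyya-type matrix is $B^{(m)}_{pq}=\langle\mathrm{Proj}_{\mathcal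 T_m}\widetilde Z^{(p)},\mathrm{Proj}_{\mathcal T_m}\widetilde Z^{(q)}\rangle$, $1\le p,q\le d$. Directional curvature. For $v\in\mathbb{R}^d$ let $\widetilde v=G^{-1}v$ (with $G$ evaluated at the fixed $\theta$, so $\widetilde v$ is a constant vector) and $\partial_v=\sum_{i=1}^d\widetilde v_i\partial_i$. Then $\Pi_v^{(m+1)}=\mathrm{Proj}_{\mathcal T_m^\perp}\big(\partial_v^{m+1}s(\theta)\big)$, where $\partial_v^{m+1}s(\theta)=\sum_{i_1,\dots,i_{m+1}}\widetilde v_{i_1}\cdots\widetilde v_{i_{m+1}}\partial_{i_1}\cdots\partial_{i_{m+1}}s(\theta)$. *)

theory Defs
  imports "HOL-Probability.Probability"
begin

section \<open>The Hilbert space \<open>L\<^sup>2(M)\<close>\<close>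

text \<open>
  Elements of \<open>L\<^sup>2(M)\<close> are represented by square-integrable functions. Equality in \<open>L\<^sup>2(M)\<close> is
  equality almost everywhere, and every notion below is invariant under that relation.
\<close>

definition L2 :: "'x measure \<Rightarrow> ('x \<Rightarrow> real) set" where
  "L2 M = {u \<in> borel_measurable M. integrable M (\<lambda>x. (u x)\<^sup>2)}"

definition L2_inner :: "'x measure \<Rightarrow> ('x \<Rightarrow> real) \<Rightarrow> ('x \<Rightarrow> real) \<Rightarrow> real" where
  "L2_inner M u w = (\<integral>x. u x * w x \<partial>M)"

definition L2_norm :: "'x measure \<Rightarrow> ('x \<Rightarrow> real) \<Rightarrow> real" where
  "L2_norm M u = sqrt (L2_inner M u u)"

definition L2_orthogonal_complement :: "'x measure \<Rightarrow> ('x \<Rightarrow> real) set \<Rightarrow> ('x \<Rightarrow> real) set" where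
  "L2_orthogonal_complement M V = {u \<in> L2 M. \<forall>w\<in>V. L2_inner M u w = 0}"

text \<open>A representative of the orthogonal projection of \<open>u\<close> onto a closed subspace \<open>V\<close>; it is
  unique up to equality almost everywhere.\<close>

definition L2_proj :: "'x measure \<Rightarrow> ('x \<Rightarrow> real) set \<Rightarrow> ('x \<Rightarrow> real) \<Rightarrow> 'x \<Rightarrow> real" where
  "L2_proj M V u = (SOME p. p \<in> V \<and> (\<forall>w\<in>V. L2_inner M (\<lambda>x. u x - p x) w = 0))"

definition L2_collinear :: "'x measure \<Rightarrow> ('x \<Rightarrow> real) \<Rightarrow> ('x \<Rightarrow> real) \<Rightarrow> bool" where
  "L2_collinear M u w \<longleftrightarrow>
     (\<exists>a b :: real. (a \<noteq> 0 \<or> b \<noteq> 0) \<and> (AE x in M. a * u x + b * w x = 0))"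


section \<open>Differentiation of \<open>L\<^sup>2(M)\<close>-valued maps\<close>

definition L2_multilinear ::
  "'x measure \<Rightarrow> nat \<Rightarrow> ((real^'n) list \<Rightarrow> 'x \<Rightarrow> real) \<Rightarrow> bool" where
  "L2_multilinear M j A \<longleftrightarrow>
     (\<forall>vs. length vs = j \<longrightarrow> A vs \<in> L2 M) \<and>
     (\<forall>us ws u v. \<forall>c::real. length us + 1 + length ws = j \<longrightarrow>
        (AE x in M. A (us @ (c *\<^sub>R u + v) # ws) x = c * A (us @ u # ws) x + A (us @ v # ws) x))"

text \<open>
  \<open>k\<close>-times Frechet differentiability of \<open>F : S \<rightarrow> L\<^sup>2(M)\<close> on an open set \<open>S\<close>. The \<open>j\<close>-th
  derivative at \<open>\<theta>\<close> is the \<open>j\<close>-linear map sending a list \<open>vs\<close> of length \<open>j\<close>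
  to \<open>D \<theta> vs\<close>; boundedness is automatic in finite dimension. The last clause says that \<open>h \<mapsto> D \<theta> (h # _)\<close> is the Frechet derivative
  at \<open>\<theta>\<close> of \<open>\<theta> \<mapsto> D \<theta>\<close> with respect to the operator norm on \<open>j\<close>-linear maps.
\<close>

definition L2_frechet_differentiable ::
  "nat \<Rightarrow> 'x measure \<Rightarrow> (real^'n) set \<Rightarrow> (real^'n \<Rightarrow> 'x \<Rightarrow> real) \<Rightarrow> bool" where
  "L2_frechet_differentiable k M S F \<longleftrightarrow>
     (\<exists>D :: real^'n \<Rightarrow> (real^'n) list \<Rightarrow> 'x \<Rightarrow> real.
        (\<forall>\<theta>\<in>S. D \<theta> [] = F \<theta>) \<and>
        (\<forall>j\<le>k. \<forall>\<theta>\<in>S. L2_multilinear M j (D \<theta>)) \<and>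
        (\<forall>j<k. \<forall>\<theta>\<in>S. \<forall>\<epsilon>>0. \<exists>\<delta>>0. \<forall>h. norm h < \<delta> \<and> \<theta> + h \<in> S \<longrightarrow>
           (\<forall>vs. length vs = j \<longrightarrow>
              L2_norm M (\<lambda>x. D (\<theta> + h) vs x - D \<theta> vs x - D \<theta> (h # vs) x)
                \<le> \<epsilon> * norm h * prod_list (map norm vs))))"

definition L2_partial ::
  "'x measure \<Rightarrow> 'n \<Rightarrow> (real^'n \<Rightarrow> 'x \<Rightarrow> real) \<Rightarrow> real^'n \<Rightarrow> 'x \<Rightarrow> real" where
  "L2_partial M i F \<theta> =
     (SOME g. g \<in> L2 M \<and>
        ((\<lambda>t. L2_norm M (\<lambda>x. (F (\<theta> + t *\<^sub>R axis i 1) x - F \<theta> x) / t - g x)) \<longlongrightarrow> 0) (at 0))"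

text \<open>The head of the list is the outermost derivative:
  \<open>[i\<^sub>1, \<dots>, i\<^sub>k]\<close> stands for \<open>\<partial>\<^bsub>i\<^sub>1\<^esub> \<dots> \<partial>\<^bsub>i\<^sub>k\<^esub>\<close>.\<close>

primrec L2_partials ::
  "'x measure \<Rightarrow> 'n list \<Rightarrow> (real^'n \<Rightarrow> 'x \<Rightarrow> real) \<Rightarrow> real^'n \<Rightarrow> 'x \<Rightarrow> real" where
  "L2_partials M [] F = F"
| "L2_partials M (i # is) F = L2_partial M i (L2_partials M is F)"


section \<open>Iterated partial derivatives of real-valued functions\<close>

definition partial_deriv :: "'n \<Rightarrow> (real^'n \<Rightarrow> real) \<Rightarrow> real^'n \<Rightarrow> real" where
  "partial_deriv i F \<theta> = deriv (\<lambda>t. F (\<theta> + t *\<^sub>R axis i 1)) 0"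

primrec partial_derivs :: "'n list \<Rightarrow> (real^'n \<Rightarrow> real) \<Rightarrow> real^'n \<Rightarrow> real" where
  "partial_derivs [] F = F"
| "partial_derivs (i # is) F = partial_deriv i (partial_derivs is F)"

primrec partial_derivs_exist :: "'n list \<Rightarrow> (real^'n) set \<Rightarrow> (real^'n \<Rightarrow> real) \<Rightarrow> bool" where
  "partial_derivs_exist [] S F \<longleftrightarrow> True"
| "partial_derivs_exist (i # is) S F \<longleftrightarrow>
     partial_derivs_exist is S F \<and>
     (\<forall>\<theta>\<in>S. (\<lambda>t. partial_derivs is F (\<theta> + t *\<^sub>R axis i 1)) differentiable (at 0))"


section \<open>Multi-indices\<close>

definition mi_order :: "('n::finite \<Rightarrow> nat) \<Rightarrow> nat" where
  "mi_order \<alpha> = (\<Sum>i\<in>UNIV. \<alpha> i)"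

definition multi_indices :: "nat \<Rightarrow> ('n::finite \<Rightarrow> nat) set" where
  "multi_indices k = {\<alpha>. 1 \<le> mi_order \<alpha> \<and> mi_order \<alpha> \<le> k}"

text \<open>The coordinates are listed in increasing order, so that this list encodes
  \<open>\<partial>\<^sup>\<alpha> = \<partial>\<^sub>1\<^bsup>\<alpha>\<^sub>1\<^esup> \<dots> \<partial>\<^sub>d\<^bsup>\<alpha>\<^sub>d\<^esup>\<close>.\<close>

definition mi_list :: "('n::{finite,linorder} \<Rightarrow> nat) \<Rightarrow> 'n list" where
  "mi_list \<alpha> = concat (map (\<lambda>i. replicate (\<alpha> i) i) (sorted_list_of_set UNIV))"


section \<open>Square-root embedding, jets and regularity\<close>

definition sqrt_embedding :: "(real^'n \<Rightarrow> 'x \<Rightarrow> real) \<Rightarrow> real^'n \<Rightarrow> 'x \<Rightarrow> real" where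
  "sqrt_embedding f \<theta> = (\<lambda>x. sqrt (f \<theta> x))"

definition eta :: "'x measure \<Rightarrow> (real^'n::{finite,linorder} \<Rightarrow> 'x \<Rightarrow> real) \<Rightarrow> real^'n::{finite,linorder} \<Rightarrow>
    ('n \<Rightarrow> nat) \<Rightarrow> 'x \<Rightarrow> real" where
  "eta M f \<theta> \<alpha> = L2_partials M (mi_list \<alpha>) (sqrt_embedding f) \<theta>"

definition jet_space :: "'x measure \<Rightarrow> (real^'n::{finite,linorder} \<Rightarrow> 'x \<Rightarrow> real) \<Rightarrow> real^'n::{finite,linorder} \<Rightarrow>
    nat \<Rightarrow> ('x \<Rightarrow> real) set" where
  "jet_space M f \<theta> m =
     {u \<in> L2 M. \<exists>c. AE x in M. u x = (\<Sum>\<alpha>\<in>multi_indices m. c \<alpha> * eta M f \<theta> \<alpha> x)}"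

definition gram_pos_def :: "'x measure \<Rightarrow> (real^'n::{finite,linorder} \<Rightarrow> 'x \<Rightarrow> real) \<Rightarrow> real^'n::{finite,linorder} \<Rightarrow>
    nat \<Rightarrow> bool" where
  "gram_pos_def M f \<theta> k \<longleftrightarrow>
     (\<forall>c :: ('n \<Rightarrow> nat) \<Rightarrow> real. (\<exists>\<alpha>\<in>multi_indices k. c \<alpha> \<noteq> 0) \<longrightarrow>
        0 < (\<Sum>\<alpha>\<in>multi_indices k. \<Sum>\<beta>\<in>multi_indices k.
               c \<alpha> * c \<beta> * L2_inner M (eta M f \<theta> \<alpha>) (eta M f \<theta> \<beta>)))"

text \<open>Interchange of \<open>\<partial>\<^sup>\<alpha>\<close> and the integral includes the existence of the derivatives and of
  the integrals on both sides.\<close>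

definition regular_of_order :: "nat \<Rightarrow> 'x measure \<Rightarrow> (real^'n::{finite,linorder}) set \<Rightarrow>
    (real^'n::{finite,linorder} \<Rightarrow> 'x measure) \<Rightarrow> (real^'n::{finite,linorder} \<Rightarrow> 'x \<Rightarrow> real) \<Rightarrow> real^'n::{finite,linorder} \<Rightarrow> bool" where
  "regular_of_order k M \<Theta> P f \<theta> \<longleftrightarrow>
     L2_frechet_differentiable k M \<Theta> (sqrt_embedding f) \<and>
     (\<forall>\<alpha>. mi_order \<alpha> \<le> k \<longrightarrow>
        (\<forall>x\<in>space M. partial_derivs_exist (mi_list \<alpha>) \<Theta> (\<lambda>\<theta>'. f \<theta>' x))) \<and>
     (\<forall>t \<in> borel_measurable M. (\<forall>\<theta>'\<in>\<Theta>. integrable (P \<theta>') (\<lambda>x. (t x)\<^sup>2 :: real)) \<longrightarrow>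
        (\<forall>\<alpha>. mi_order \<alpha> \<le> k \<longrightarrow>
           partial_derivs_exist (mi_list \<alpha>) \<Theta> (\<lambda>\<theta>'. \<integral>x. t x * f \<theta>' x \<partial>M) \<and>
           (\<forall>\<theta>'\<in>\<Theta>.
              integrable M (\<lambda>x. t x * partial_derivs (mi_list \<alpha>) (\<lambda>\<theta>''. f \<theta>'' x) \<theta>') \<and>
              partial_derivs (mi_list \<alpha>) (\<lambda>\<theta>''. \<integral>x. t x * f \<theta>'' x \<partial>M) \<theta>' =
                (\<integral>x. t x * partial_derivs (mi_list \<alpha>) (\<lambda>\<theta>''. f \<theta>'' x) \<theta>' \<partial>M)))) \<and>
     gram_pos_def M f \<theta> k"


section \<open>Covariance, Bhattacharyya-type matrix and directional curvature\<close>

definition covariance_matrix :: "(real^'n \<Rightarrow> 'x measure) \<Rightarrow> ('x \<Rightarrow> real^'n) \<Rightarrow> real^'n \<Rightarrow>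
    real^'n^'n" where
  "covariance_matrix P T \<theta> = (\<chi> p q. \<integral>x. (T x $ p - \<theta> $ p) * (T x $ q - \<theta> $ q) \<partial>P \<theta>)"

definition lifted_error :: "(real^'n \<Rightarrow> 'x \<Rightarrow> real) \<Rightarrow> ('x \<Rightarrow> real^'n) \<Rightarrow> real^'n \<Rightarrow> 'n \<Rightarrow>
    'x \<Rightarrow> real" where
  "lifted_error f T \<theta> p = (\<lambda>x. (T x $ p - \<theta> $ p) * sqrt_embedding f \<theta> x)"

definition lifted_error_dir :: "(real^'n \<Rightarrow> 'x \<Rightarrow> real) \<Rightarrow> ('x \<Rightarrow> real^'n) \<Rightarrow> real^'n \<Rightarrow>
    real^'n \<Rightarrow> 'x \<Rightarrow> real" where
  "lifted_error_dir f T \<theta> v = (\<lambda>x. \<Sum>p\<in>UNIV. v $ p * lifted_error f T \<theta> p x)"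

definition bhattacharyya_matrix :: "'x measure \<Rightarrow> (real^'n::{finite,linorder} \<Rightarrow> 'x \<Rightarrow> real) \<Rightarrow>
    ('x \<Rightarrow> real^'n::{finite,linorder}) \<Rightarrow> real^'n::{finite,linorder} \<Rightarrow> nat \<Rightarrow> real^'n::{finite,linorder}^'n::{finite,linorder}" where
  "bhattacharyya_matrix M f T \<theta> m =
     (\<chi> p q. L2_inner M (L2_proj M (jet_space M f \<theta> m) (lifted_error f T \<theta> p))
                        (L2_proj M (jet_space M f \<theta> m) (lifted_error f T \<theta> q)))"

definition metric_matrix :: "'x measure \<Rightarrow> (real^'n \<Rightarrow> 'x \<Rightarrow> real) \<Rightarrow> real^'n \<Rightarrow> real^'n^'n" where
  "metric_matrix M f \<theta> =
     (\<chi> i j. L2_inner M (L2_partial M i (sqrt_embedding f) \<theta>)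
                        (L2_partial M j (sqrt_embedding f) \<theta>))"

text \<open>The \<open>k\<close>-th power of \<open>\<partial>\<^sub>w = \<Sum>\<^sub>i w\<^sub>i \<partial>\<^sub>i\<close> for a constant vector \<open>w\<close>.\<close>

definition L2_dir_deriv :: "'x measure \<Rightarrow> nat \<Rightarrow> real^'n \<Rightarrow> (real^'n \<Rightarrow> 'x \<Rightarrow> real) \<Rightarrow> real^'n \<Rightarrow>
    'x \<Rightarrow> real" where
  "L2_dir_deriv M k w F \<theta> =
     (\<lambda>x. \<Sum>is | length is = k. prod_list (map (\<lambda>i. w $ i) is) * L2_partials M is F \<theta> x)"

text \<open>\<open>directional_curvature M f \<theta> m v\<close> is \<open>\<Pi>\<^sub>v\<^bsup>(m+1)\<^esup>\<close>.\<close>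

definition directional_curvature :: "'x measure \<Rightarrow> (real^'n::{finite,linorder} \<Rightarrow> 'x \<Rightarrow> real) \<Rightarrow>
    real^'n::{finite,linorder} \<Rightarrow> nat \<Rightarrow> real^'n::{finite,linorder} \<Rightarrow> 'x \<Rightarrow> real" where
  "directional_curvature M f \<theta> m v =
     L2_proj M (L2_orthogonal_complement M (jet_space M f \<theta> m))
       (L2_dir_deriv M (m + 1) (matrix_inv (metric_matrix M f \<theta>) *v v) (sqrt_embedding f) \<theta>)"

end

theory Submission
  imports Defs
begin

text \<open>
  With \<open>N = Z\<^sub>v - Proj Z\<^sub>v\<close>, the left-hand side is \<open>\<parallel>N\<parallel>\<^sup>2\<close>, and \<open>\<langle>Z\<^sub>v, \<Pi>\<rangle> = \<langle>N, \<Pi>\<rangle>\<close> because \<open>\<Pi>\<close> is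
  orthogonal to the jet space. The inequality is Cauchy-Schwarz for \<open>N\<close> and \<open>\<Pi>\<close>, and so is the equality
  case when \<open>\<Pi> \<noteq> 0\<close>. For \<open>\<Pi> = 0\<close> the equivalence requires \<open>N = 0\<close>, which holds since \<open>\<Pi> = 0\<close> forces
  \<open>v = 0\<close>: as mixed \<open>L\<^sup>2\<close>-derivatives commute (Schwarz's theorem, applied to the scalar functions
  \<open>\<langle>g, s\<rangle>\<close>), \<open>\<partial>\<^sub>v\<^bsup>m+1\<^esup> s\<close> is a combination of the linearly independent \<open>\<eta>\<^sub>\<alpha>\<close>, \<open>|\<alpha>| = m + 1\<close>, in which
  \<open>\<partial>\<^sub>i\<^bsup>m+1\<^esup> s\<close> has coefficient \<open>w\<^sub>i\<^bsup>m+1\<^esup>\<close>, where \<open>w = G\<^sup>-\<^sup>1 v\<close>.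
\<close>

section \<open>Algebra of representatives in L2, up to Cauchy-Schwarz and its equality case\<close>

section \<open>Square-integrable functions\<close>

text \<open>Domination by \<open>u^2 + w^2\<close>. Inner products of members are thus genuine
  integrals, not the default value 0 of a divergent one, which is what makes \<open>L2_inner\<close>
  bilinear.\<close>

lemma L2_integrable_mult:
  assumes "u \<in> L2 M" "w \<in> L2 M"
  shows "integrable M (\<lambda>x. u x * w x)"
proof (rule Bochner_Integration.integrable_bound)
  show "integrable M (\<lambda>x. (u x)\<^sup>2 + (w x)\<^sup>2)"
    using assms by (auto simp: L2_def)
  show "(\<lambda>x. u x * w x) \<in> borel_measurable M"
    using assms by (auto simp: L2_def)
  have "\<bar>a * b\<bar> \<le> a\<^sup>2 + b\<^sup>2" for a b :: real
  proof -
    have "2 * \<bar>a\<bar> * \<bar>b\<bar> \<le> a\<^sup>2 + b\<^sup>2"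
      using sum_squares_bound[of "\<bar>a\<bar>" "\<bar>b\<bar>"] by simp
    moreover have "0 \<le> \<bar>a\<bar> * \<bar>b\<bar>" by simp
    ultimately show ?thesis unfolding abs_mult by linarith
  qed
  then show "AE x in M. norm (u x * w x) \<le> norm ((u x)\<^sup>2 + (w x)\<^sup>2)"
    by simp
qed

lemma L2_zero: "(\<lambda>x. 0) \<in> L2 M"
  by (simp add: L2_def)

lemma L2_add:
  assumes "u \<in> L2 M" "w \<in> L2 M"
  shows "(\<lambda>x. u x + w x) \<in> L2 M"
proof -
  have "integrable M (\<lambda>x. (u x)\<^sup>2 + (w x)\<^sup>2 + 2 * (u x * w x))"
    using assms L2_integrable_mult[OF assms] by (auto simp: L2_def)
  moreover have "(\<lambda>x. (u x)\<^sup>2 + (w x)\<^sup>2 + 2 * (u x * w x)) = (\<lambda>x. (u x + w x)\<^sup>2)"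
    by (auto simp: power2_sum)
  ultimately show ?thesis
    using assms by (auto simp: L2_def)
qed

lemma L2_scale: "u \<in> L2 M \<Longrightarrow> (\<lambda>x. c * u x) \<in> L2 M"
  by (auto simp: L2_def power_mult_distrib)

lemma L2_diff:
  assumes "u \<in> L2 M" "w \<in> L2 M"
  shows "(\<lambda>x. u x - w x) \<in> L2 M"
  using L2_add[OF assms(1) L2_scale[OF assms(2), of "-1"]] by simp

lemma L2_divide: "u \<in> L2 M \<Longrightarrow> (\<lambda>x. u x / c) \<in> L2 M"
  using L2_scale[of u M "inverse c"] by (simp add: field_simps)

lemma L2_sum: "(\<And>i. i \<in> A \<Longrightarrow> u i \<in> L2 M) \<Longrightarrow> (\<lambda>x. \<Sum>i\<in>A. u i x) \<in> L2 M"
  by (induction A rule: infinite_finite_induct) (auto intro: L2_zero L2_add)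

lemma L2_lincomb: "(\<And>i. i \<in> A \<Longrightarrow> u i \<in> L2 M) \<Longrightarrow> (\<lambda>x. \<Sum>i\<in>A. c i * u i x) \<in> L2 M"
  by (intro L2_sum L2_scale)

lemmas L2_intros = L2_zero L2_add L2_scale L2_diff L2_divide L2_lincomb

lemma L2_inner_commute: "L2_inner M u w = L2_inner M w u"
  by (simp add: L2_inner_def mult.commute)

lemma L2_inner_cong_AE:
  assumes "u \<in> L2 M" "u' \<in> L2 M" "w \<in> L2 M" "w' \<in> L2 M"
    and "AE x in M. u x = u' x" "AE x in M. w x = w' x"
  shows "L2_inner M u w = L2_inner M u' w'"
  unfolding L2_inner_def using assms by (intro integral_cong_AE) (auto simp: L2_def)

lemma L2_inner_add_left:
  assumes "u \<in> L2 M" "w \<in> L2 M" "z \<in> L2 M"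
  shows "L2_inner M (\<lambda>x. u x + w x) z = L2_inner M u z + L2_inner M w z"
  using L2_integrable_mult[OF assms(1,3)] L2_integrable_mult[OF assms(2,3)]
  by (simp add: L2_inner_def distrib_right)

lemma L2_inner_scale_left: "L2_inner M (\<lambda>x. c * u x) z = c * L2_inner M u z"
  by (simp add: L2_inner_def mult.assoc)

lemma L2_inner_diff_left:
  assumes "u \<in> L2 M" "w \<in> L2 M" "z \<in> L2 M"
  shows "L2_inner M (\<lambda>x. u x - w x) z = L2_inner M u z - L2_inner M w z"
  using L2_integrable_mult[OF assms(1,3)] L2_integrable_mult[OF assms(2,3)]
  by (simp add: L2_inner_def left_diff_distrib)

lemma L2_inner_add_right:
  assumes "u \<in> L2 M" "w \<in> L2 M" "z \<in> L2 M"
  shows "L2_inner M z (\<lambda>x. u x + w x) = L2_inner M z u + L2_inner M z w"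
  using L2_inner_add_left[OF assms] by (simp add: L2_inner_commute)

lemma L2_inner_diff_right:
  assumes "u \<in> L2 M" "w \<in> L2 M" "z \<in> L2 M"
  shows "L2_inner M z (\<lambda>x. u x - w x) = L2_inner M z u - L2_inner M z w"
  using L2_inner_diff_left[OF assms] by (simp add: L2_inner_commute)

lemma L2_inner_scale_right: "L2_inner M z (\<lambda>x. c * u x) = c * L2_inner M z u"
  using L2_inner_scale_left by (metis L2_inner_commute)

lemma L2_inner_lincomb_left:
  assumes "\<And>i. i \<in> A \<Longrightarrow> u i \<in> L2 M" "z \<in> L2 M"
  shows "L2_inner M (\<lambda>x. \<Sum>i\<in>A. c i * u i x) z = (\<Sum>i\<in>A. c i * L2_inner M (u i) z)"
  using assms
proof (induction A rule: infinite_finite_induct)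
  case (insert a A)
  then show ?case
    by (simp add: L2_inner_add_left L2_scale L2_lincomb L2_inner_scale_left)
qed (auto simp: L2_inner_def)

lemma L2_inner_lincomb_right:
  assumes "\<And>i. i \<in> A \<Longrightarrow> u i \<in> L2 M" "z \<in> L2 M"
  shows "L2_inner M z (\<lambda>x. \<Sum>i\<in>A. c i * u i x) = (\<Sum>i\<in>A. c i * L2_inner M z (u i))"
  using L2_inner_lincomb_left[OF assms, where c = c] by (simp add: L2_inner_commute)

lemma L2_inner_self_nonneg: "0 \<le> L2_inner M u u"
  by (simp add: L2_inner_def)

lemma L2_norm_nonneg: "0 \<le> L2_norm M u"
  by (simp add: L2_norm_def L2_inner_self_nonneg)

lemma L2_norm_square: "(L2_norm M u)\<^sup>2 = L2_inner M u u"
  by (simp add: L2_norm_def L2_inner_self_nonneg)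

lemma L2_inner_self_eq_0_iff:
  assumes "u \<in> L2 M"
  shows "L2_inner M u u = 0 \<longleftrightarrow> (AE x in M. u x = 0)"
  unfolding L2_inner_def
  using integral_nonneg_eq_0_iff_AE[OF L2_integrable_mult[OF assms assms]] by simp

lemma L2_norm_eq_0_iff: "u \<in> L2 M \<Longrightarrow> L2_norm M u = 0 \<longleftrightarrow> (AE x in M. u x = 0)"
  by (simp add: L2_norm_def L2_inner_self_eq_0_iff)

lemma L2_norm_cong_AE:
  assumes "u \<in> L2 M" "w \<in> L2 M" "AE x in M. u x = w x"
  shows "L2_norm M u = L2_norm M w"
  using L2_inner_cong_AE[OF assms(1,2,1,2,3,3)] by (simp add: L2_norm_def)

lemma L2_norm_scale: "L2_norm M (\<lambda>x. c * u x) = \<bar>c\<bar> * L2_norm M u"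
  by (simp add: L2_norm_def L2_inner_scale_left L2_inner_scale_right real_sqrt_mult mult.assoc[symmetric])

lemma L2_inner_eq_0_if_AE_0:
  assumes "AE x in M. w x = 0" "u \<in> L2 M" "w \<in> L2 M"
  shows "L2_inner M u w = 0"
  using L2_inner_cong_AE[OF assms(2,2,3) L2_zero _ assms(1)] by (simp add: L2_inner_def)

text \<open>Pythagoras for the residual of \<open>u\<close> along the line spanned by
  \<open>w\<close>. Cauchy-Schwarz and the characterization of equality in it are both read off from
  this identity.\<close>

lemma L2_norm_residual:
  assumes u: "u \<in> L2 M" and w: "w \<in> L2 M" and nz: "L2_inner M w w \<noteq> 0"
  defines "c \<equiv> L2_inner M u w / L2_inner M w w"
  shows "L2_inner M (\<lambda>x. u x - c * w x) (\<lambda>x. u x - c * w x)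
    = L2_inner M u u - (L2_inner M u w)\<^sup>2 / L2_inner M w w"
proof -
  have "L2_inner M (\<lambda>x. u x - c * w x) (\<lambda>x. u x - c * w x)
      = L2_inner M u u - 2 * c * L2_inner M u w + c * c * L2_inner M w w"
    using u w by (simp add: L2_inner_diff_left L2_inner_diff_right L2_intros L2_inner_scale_left
        L2_inner_scale_right L2_inner_commute[of M w u] algebra_simps)
  also have "\<dots> = L2_inner M u u - (L2_inner M u w)\<^sup>2 / L2_inner M w w"
    using nz by (simp add: c_def power2_eq_square)
  finally show ?thesis .
qed

lemma L2_Cauchy_Schwarz_square:
  assumes "u \<in> L2 M" "w \<in> L2 M"
  shows "(L2_inner M u w)\<^sup>2 \<le> L2_inner M u u * L2_inner M w w"
proof (cases "L2_inner M w w = 0")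
  case True
  then show ?thesis
    using assms by (simp add: L2_inner_self_eq_0_iff L2_inner_eq_0_if_AE_0)
next
  case False
  then have "0 < L2_inner M w w"
    using L2_inner_self_nonneg[of M w] by simp
  then show ?thesis
    using L2_norm_residual[OF assms False] L2_inner_self_nonneg
    by (metis diff_ge_0_iff_ge pos_divide_le_eq)
qed

lemma L2_Cauchy_Schwarz:
  assumes "u \<in> L2 M" "w \<in> L2 M"
  shows "\<bar>L2_inner M u w\<bar> \<le> L2_norm M u * L2_norm M w"
  using real_sqrt_le_mono[OF L2_Cauchy_Schwarz_square[OF assms]]
  by (simp add: L2_norm_def real_sqrt_mult)

lemma L2_norm_add_le:
  assumes "u \<in> L2 M" "w \<in> L2 M"
  shows "L2_norm M (\<lambda>x. u x + w x) \<le> L2_norm M u + L2_norm M w"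
proof (rule power2_le_imp_le)
  show "(L2_norm M (\<lambda>x. u x + w x))\<^sup>2 \<le> (L2_norm M u + L2_norm M w)\<^sup>2"
    using assms L2_Cauchy_Schwarz[OF assms]
    by (simp add: power2_sum L2_norm_square L2_inner_add_left L2_inner_add_right L2_intros
        L2_inner_commute[of M w u])
qed (simp add: L2_norm_nonneg)

text \<open>Equality means that the residual \<open>u - c w\<close> has norm zero. Conversely, in a
  nontrivial relation \<open>a u + b w = 0\<close> the coefficient \<open>a\<close> cannot vanish,
  as \<open>w\<close> is not null, and pairing with \<open>w\<close> identifies
  \<open>- b / a\<close> with \<open>c\<close>.\<close>

lemma L2_Cauchy_Schwarz_collinear_iff:
  assumes u: "u \<in> L2 M" and w: "w \<in> L2 M" and nz: "\<not> (AE x in M. w x = 0)"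
  shows "L2_inner M u u = (L2_inner M u w)\<^sup>2 / L2_inner M w w \<longleftrightarrow> L2_collinear M u w"
proof -
  have ww: "L2_inner M w w \<noteq> 0"
    using w nz by (simp add: L2_inner_self_eq_0_iff)
  define c where "c = L2_inner M u w / L2_inner M w w"
  have res: "(\<lambda>x. u x - c * w x) \<in> L2 M"
    using u w by (intro L2_intros)
  have "L2_inner M u u = (L2_inner M u w)\<^sup>2 / L2_inner M w w \<longleftrightarrow> (AE x in M. u x - c * w x = 0)"
    using L2_norm_residual[OF u w ww] L2_inner_self_eq_0_iff[OF res] by (simp add: c_def)
  also have "\<dots> \<longleftrightarrow> L2_collinear M u w"
  proof
    assume "AE x in M. u x - c * w x = 0"
    then have "AE x in M. 1 * u x + (- c) * w x = 0" by simp
    then show "L2_collinear M u w"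
      unfolding L2_collinear_def by (metis zero_neq_one)
  next
    assume "L2_collinear M u w"
    then obtain a b where ab: "a \<noteq> 0 \<or> b \<noteq> 0" and AE: "AE x in M. a * u x + b * w x = 0"
      unfolding L2_collinear_def by blast
    have "a \<noteq> 0"
    proof
      assume "a = 0"
      with ab AE have "AE x in M. w x = 0" by simp
      with nz show False ..
    qed
    then have u_eq: "AE x in M. u x = (- b / a) * w x"
      using AE by (auto elim!: eventually_mono simp: field_simps add_eq_0_iff)
    have "L2_inner M u w = L2_inner M (\<lambda>x. (- b / a) * w x) w"
      by (rule L2_inner_cong_AE[OF u L2_scale[OF w] w w u_eq]) simp
    also have "\<dots> = (- b / a) * L2_inner M w w"
      by (rule L2_inner_scale_left)
    finally have "L2_inner M u w = (- b / a) * L2_inner M w w" .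
    then have "c = - b / a"
      using ww by (simp add: c_def)
    then show "AE x in M. u x - c * w x = 0"
      using u_eq by (simp only: right_minus_eq)
  qed
  finally show ?thesis .
qed


section \<open>Finite spans in L2 and orthogonal projections onto them and onto their
  complements\<close>

section \<open>Spans and projections\<close>

text \<open>This is a purely linear notion; existence of projections is supplied separately for
  finite spans and their complements. The single closure condition covers sums, differences and
  multiples.\<close>

definition L2_subspace :: "'x measure \<Rightarrow> ('x \<Rightarrow> real) set \<Rightarrow> bool" where
  "L2_subspace M V \<longleftrightarrow> V \<subseteq> L2 M \<and> (\<lambda>x. 0) \<in> V \<and>
     (\<forall>u\<in>V. \<forall>w\<in>V. \<forall>c. (\<lambda>x. u x + c * w x) \<in> V)"

lemma L2_subspace_in_L2: "L2_subspace M V \<Longrightarrow> u \<in> V \<Longrightarrow> u \<in> L2 M"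
  by (auto simp: L2_subspace_def)

lemma L2_subspace_add: "L2_subspace M V \<Longrightarrow> u \<in> V \<Longrightarrow> w \<in> V \<Longrightarrow> (\<lambda>x. u x + c * w x) \<in> V"
  by (auto simp: L2_subspace_def)

lemma L2_subspace_diff:
  assumes "L2_subspace M V" "u \<in> V" "w \<in> V"
  shows "(\<lambda>x. u x - w x) \<in> V"
  using L2_subspace_add[OF assms, of "-1"] by simp

lemma L2_subspace_lincomb:
  assumes "L2_subspace M V" "\<And>i. i \<in> A \<Longrightarrow> u i \<in> V"
  shows "(\<lambda>x. \<Sum>i\<in>A. c i * u i x) \<in> V"
  using assms(2)
proof (induction A rule: infinite_finite_induct)
  case (insert a A)
  then show ?case
    using L2_subspace_add[OF assms(1), of "\<lambda>x. \<Sum>i\<in>A. c i * u i x" "u a" "c a"]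
    by (simp add: add.commute)
qed (use assms(1) in \<open>auto simp: L2_subspace_def\<close>)

lemma L2_subspace_orthogonal_complement:
  assumes "L2_subspace M V"
  shows "L2_subspace M (L2_orthogonal_complement M V)"
proof -
  have "L2_inner M (\<lambda>x. 0) w = 0" for w
    by (simp add: L2_inner_def)
  then show ?thesis
    using L2_subspace_in_L2[OF assms] unfolding L2_subspace_def[of _ "L2_orthogonal_complement M V"]
    by (auto simp: L2_orthogonal_complement_def L2_inner_add_left L2_inner_scale_left L2_intros)
qed

text \<open>Saturated under almost-everywhere equality, exactly as \<open>jet_space\<close> is, so
  that facts about indexed families apply to jets directly.\<close>

definition L2_span :: "'x measure \<Rightarrow> 'i set \<Rightarrow> ('i \<Rightarrow> 'x \<Rightarrow> real) \<Rightarrow> ('x \<Rightarrow> real) set" where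
  "L2_span M A e = {u \<in> L2 M. \<exists>c. AE x in M. u x = (\<Sum>i\<in>A. c i * e i x)}"

lemma L2_subspace_span:
  "L2_subspace M (L2_span M A e)"
proof -
  have "(\<lambda>x. u x + k * w x) \<in> L2_span M A e" if "u \<in> L2_span M A e" "w \<in> L2_span M A e" for u w k
  proof -
    obtain a b where "AE x in M. u x = (\<Sum>i\<in>A. a i * e i x)" "AE x in M. w x = (\<Sum>i\<in>A. b i * e i x)"
      using \<open>u \<in> _\<close> \<open>w \<in> _\<close> by (auto simp: L2_span_def)
    then have "AE x in M. u x + k * w x = (\<Sum>i\<in>A. (a i + k * b i) * e i x)"
      by eventually_elim (simp add: sum.distrib sum_distrib_left algebra_simps)
    then show ?thesis
      unfolding L2_span_def using that
      by (auto simp: L2_span_def intro!: L2_intros exI[of _ "\<lambda>i. a i + k * b i"])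
  qed
  moreover have "(\<lambda>x. 0) \<in> L2_span M A e"
    by (auto simp: L2_span_def L2_zero intro!: exI[of _ "\<lambda>i. 0"])
  ultimately show ?thesis
    by (auto simp: L2_subspace_def L2_span_def)
qed

text \<open>Coefficients are padded with 0. Finiteness of \<open>B\<close> matters because a sum
  over an infinite set defaults to 0.\<close>

lemma L2_span_mono:
  assumes "finite B" "A \<subseteq> B"
  shows "L2_span M A e \<subseteq> L2_span M B e"
proof
  fix u assume "u \<in> L2_span M A e"
  then obtain c where c: "AE x in M. u x = (\<Sum>i\<in>A. c i * e i x)" and u: "u \<in> L2 M"
    by (auto simp: L2_span_def)
  have "(\<Sum>i\<in>B. (if i \<in> A then c i else 0) * e i x) = (\<Sum>i\<in>A. c i * e i x)" for x
    using assms by (intro sum.mono_neutral_cong_right) auto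
  with c u show "u \<in> L2_span M B e"
    by (auto simp: L2_span_def intro!: exI[of _ "\<lambda>i. if i \<in> A then c i else 0"])
qed

lemma L2_span_base:
  assumes "finite A" "i \<in> A" "e i \<in> L2 M"
  shows "e i \<in> L2_span M A e"
  using assms
  by (auto simp: L2_span_def if_distrib[of "\<lambda>c. c * _"] sum.delta intro!: exI[of _ "\<lambda>j. if j = i then 1 else 0"]
      cong: if_cong)

lemma L2_orthogonal_span:
  assumes "\<And>i. i \<in> A \<Longrightarrow> e i \<in> L2 M" "u \<in> L2 M" "\<And>i. i \<in> A \<Longrightarrow> L2_inner M u (e i) = 0"
    and "w \<in> L2_span M A e"
  shows "L2_inner M u w = 0"
proof -
  obtain c where c: "AE x in M. w x = (\<Sum>i\<in>A. c i * e i x)" and w: "w \<in> L2 M"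
    using assms(4) by (auto simp: L2_span_def)
  have "L2_inner M u w = L2_inner M u (\<lambda>x. \<Sum>i\<in>A. c i * e i x)"
    using c w assms by (intro L2_inner_cong_AE L2_lincomb) auto
  also have "\<dots> = 0"
    using assms by (simp add: L2_inner_lincomb_right)
  finally show ?thesis .
qed

text \<open>One Gram-Schmidt step per generator: the new generator \<open>e a\<close> is replaced by
  its residual \<open>r\<close> against the old span, and a multiple of \<open>r\<close> corrects
  the old projection of \<open>u\<close>. The generators may be dependent, so \<open>r\<close> may
  be null.\<close>

lemma L2_span_proj_exists:
  assumes "finite A" "\<And>i. i \<in> A \<Longrightarrow> e i \<in> L2 M" "u \<in> L2 M"
  shows "\<exists>p \<in> L2_span M A e. \<forall>w \<in> L2_span M A e. L2_inner M (\<lambda>x. u x - p x) w = 0"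
  using assms
proof (induction A arbitrary: u rule: finite_induct)
  case empty
  then show ?case
    using L2_orthogonal_span[of "{}" e M u]
    by (intro bexI[of _ "\<lambda>x. 0"]) (auto simp: L2_span_def L2_zero)
next
  case (insert a A)
  let ?W = "L2_span M A e" and ?V = "L2_span M (insert a A) e"
  have eL2: "\<And>i. i \<in> insert a A \<Longrightarrow> e i \<in> L2 M" by fact
  have sub: "?W \<subseteq> ?V" using insert by (intro L2_span_mono) auto
  note V = L2_subspace_span[of M "insert a A" e]
  note inL2 = L2_subspace_in_L2[OF V]
  obtain q where q: "q \<in> ?W" "\<forall>w\<in>?W. L2_inner M (\<lambda>x. e a x - q x) w = 0"
    using insert.IH[of "e a"] eL2 by auto
  obtain p where p: "p \<in> ?W" "\<forall>w\<in>?W. L2_inner M (\<lambda>x. u x - p x) w = 0"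
    using insert.IH[of u] insert.prems by auto
  define r where "r = (\<lambda>x. e a x - q x)"
  have "e a \<in> ?V" using insert by (intro L2_span_base) auto
  then have rV: "r \<in> ?V"
    unfolding r_def using q sub by (intro L2_subspace_diff[OF V]) auto
  \<comment> \<open>For null \<open>r\<close> the division yields \<open>c = 0\<close>; the equation
    below survives, since \<open>u\<close> is then orthogonal to \<open>r\<close> as well.\<close>
  define c where "c = L2_inner M u r / L2_inner M r r"
  have c: "L2_inner M u r = c * L2_inner M r r"
  proof (cases "L2_inner M r r = 0")
    case True
    with inL2[OF rV] insert.prems show ?thesis
      by (simp add: L2_inner_self_eq_0_iff L2_inner_eq_0_if_AE_0)
  qed (simp add: c_def)
  define p' where "p' = (\<lambda>x. p x + c * r x)"
  have p'V: "p' \<in> ?V"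
    unfolding p'_def using rV p sub by (intro L2_subspace_add[OF V]) auto
  have r_orth: "L2_inner M r w = 0" if "w \<in> ?W" for w
    using q that by (simp add: r_def)
  have mem: "u \<in> L2 M" "p \<in> L2 M" "q \<in> L2 M" "r \<in> L2 M" "p' \<in> L2 M"
    using insert.prems p q rV p'V sub inL2 by auto
  have dec: "L2_inner M (\<lambda>x. u x - p' x) w = L2_inner M (\<lambda>x. u x - p x) w - c * L2_inner M r w"
    if "w \<in> L2 M" for w
    using mem that
    by (simp add: p'_def L2_inner_diff_left L2_inner_add_left L2_inner_scale_left L2_intros)
  have orthW: "L2_inner M (\<lambda>x. u x - p' x) w = 0" if "w \<in> ?W" for w
    using that dec[of w] r_orth p(2) sub inL2 by auto
  have "L2_inner M (\<lambda>x. u x - p' x) r = 0"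
    using dec[of r] c r_orth[OF p(1)] mem by (simp add: L2_inner_diff_left L2_inner_commute[of M p r])
  \<comment> \<open>Since \<open>q\<close> lies in the old span, orthogonality to \<open>r\<close>
    and to that span gives orthogonality to \<open>e a\<close>.\<close>
  moreover have "e a = (\<lambda>x. r x + q x)" by (simp add: r_def)
  ultimately have "L2_inner M (\<lambda>x. u x - p' x) (e a) = 0"
    using orthW[OF q(1)] mem by (simp add: L2_inner_add_right L2_intros)
  moreover have "L2_inner M (\<lambda>x. u x - p' x) (e i) = 0" if "i \<in> A" for i
    using that insert by (intro orthW L2_span_base) auto
  ultimately have "L2_inner M (\<lambda>x. u x - p' x) w = 0" if "w \<in> ?V" for w
    using that mem eL2 by (intro L2_orthogonal_span[of "insert a A" e M _ w]) (auto intro: L2_intros)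
  then show ?case using p'V by blast
qed

text \<open>Existence turns the choice in \<open>L2_proj\<close> into an actual projection.\<close>

lemma L2_proj_span:
  assumes "finite A" "\<And>i. i \<in> A \<Longrightarrow> e i \<in> L2 M" "u \<in> L2 M"
  shows "L2_proj M (L2_span M A e) u \<in> L2_span M A e"
    and "w \<in> L2_span M A e \<Longrightarrow> L2_inner M (\<lambda>x. u x - L2_proj M (L2_span M A e) u x) w = 0"
  using someI_ex[OF L2_span_proj_exists[OF assms, unfolded Bex_def]]
  by (auto simp: L2_proj_def)

text \<open>The difference \<open>d\<close> of two candidates lies in \<open>V\<close>, and both
  residuals are orthogonal to it, so \<open>d\<close> is orthogonal to itself. An arbitrary subspace
  is allowed because both spans and complements of spans occur as \<open>V\<close>.\<close>

lemma L2_proj_unique: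
  assumes V: "L2_subspace M V" and u: "u \<in> L2 M"
    and p: "p \<in> V" "\<And>w. w \<in> V \<Longrightarrow> L2_inner M (\<lambda>x. u x - p x) w = 0"
    and q: "q \<in> V" "\<And>w. w \<in> V \<Longrightarrow> L2_inner M (\<lambda>x. u x - q x) w = 0"
  shows "AE x in M. p x = q x"
proof -
  define d where "d = (\<lambda>x. p x - q x)"
  have d: "d \<in> V" unfolding d_def using V p q by (intro L2_subspace_diff)
  note mem = u L2_subspace_in_L2[OF V p(1)] L2_subspace_in_L2[OF V q(1)] L2_subspace_in_L2[OF V d]
  have "L2_inner M d d = L2_inner M (\<lambda>x. u x - q x) d - L2_inner M (\<lambda>x. u x - p x) d"
    using mem by (subst (1) d_def) (simp add: L2_inner_diff_left)
  also have "\<dots> = 0" using p q d by simp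
  finally have "AE x in M. d x = 0"
    using mem by (simp add: L2_inner_self_eq_0_iff)
  then show ?thesis by (simp add: d_def)
qed

text \<open>The complement of a span is infinite-dimensional in general; the projection onto it exists
  because the residual of the projection onto the span is one.\<close>

lemma L2_proj_complement_span:
  assumes "finite A" "\<And>i. i \<in> A \<Longrightarrow> e i \<in> L2 M" "u \<in> L2 M"
  defines "V \<equiv> L2_span M A e"
  shows "L2_proj M (L2_orthogonal_complement M V) u \<in> L2_orthogonal_complement M V"
    and "AE x in M. L2_proj M (L2_orthogonal_complement M V) u x = u x - L2_proj M V u x"
proof -
  let ?C = "L2_orthogonal_complement M V" and ?p = "L2_proj M V u"
  have V: "L2_subspace M V" unfolding V_def by (rule L2_subspace_span)
  have p: "?p \<in> V" "\<And>w. w \<in> V \<Longrightarrow> L2_inner M (\<lambda>x. u x - ?p x) w = 0"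
    using L2_proj_span[OF assms(1-3)] by (auto simp: V_def)
  have r: "(\<lambda>x. u x - ?p x) \<in> ?C"
    using p L2_subspace_in_L2[OF V] assms(3) by (auto simp: L2_orthogonal_complement_def intro: L2_diff)
  have r': "L2_inner M (\<lambda>x. u x - (u x - ?p x)) w = 0" if "w \<in> ?C" for w
    using that p(1) by (simp add: L2_orthogonal_complement_def L2_inner_commute[of M ?p])
  have *: "L2_proj M ?C u \<in> ?C \<and> (\<forall>w\<in>?C. L2_inner M (\<lambda>x. u x - L2_proj M ?C u x) w = 0)"
    unfolding L2_proj_def[of M ?C] by (rule someI[of _ "\<lambda>x. u x - ?p x"]) (use r r' in auto)
  then show "L2_proj M ?C u \<in> ?C" by blast
  show "AE x in M. L2_proj M ?C u x = u x - ?p x"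
    using L2_proj_unique[OF L2_subspace_orthogonal_complement[OF V] assms(3), of "L2_proj M ?C u" "\<lambda>x. u x - ?p x"]
      * r r' by blast
qed

section \<open>Schwarz's theorem for scalar functions and its transfer to derivatives in L2\<close>

section \<open>Symmetry of derivatives\<close>

text \<open>The mean value theorem in direction \<open>a\<close> reduces the second difference to a
  difference of first derivatives; differentiability of \<open>\<phi>' y a\<close> at the single
  point \<open>\<theta>\<close> then gives its first-order expansion.\<close>

lemma second_difference_tendsto:
  fixes \<phi> :: "'a::real_normed_vector \<Rightarrow> real"
  assumes S: "open S" "\<theta> \<in> S"
    and d1: "\<And>y. y \<in> S \<Longrightarrow> (\<phi> has_derivative \<phi>' y) (at y)"
    and d2: "((\<lambda>y. \<phi>' y a) has_derivative A) (at \<theta>)"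
  shows "((\<lambda>t. (\<phi> (\<theta> + t *\<^sub>R a + t *\<^sub>R b) - \<phi> (\<theta> + t *\<^sub>R a) - \<phi> (\<theta> + t *\<^sub>R b) + \<phi> \<theta>) / t\<^sup>2)
    \<longlongrightarrow> A b) (at_right 0)"
proof (rule tendstoI)
  fix \<epsilon> :: real assume "\<epsilon> > 0"
  \<comment> \<open>The factor 2 accounts for the two expansions subtracted below; the summand 1
    keeps \<open>K\<close> positive when \<open>a = b = 0\<close>. The choice of \<open>e\<close>
    makes \<open>e * K\<close> equal to half of \<open>\<epsilon>\<close>, hence a strict bound at
    the end.\<close>
  define K where "K = 2 * (norm a + norm b) + 1"
  have K: "K > 0" by (simp add: K_def add_nonneg_pos)
  define e where "e = \<epsilon> / (2 * K)"
  have e: "e > 0" using \<open>\<epsilon> > 0\<close> K by (simp add: e_def)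
  interpret A: bounded_linear A using d2 by (rule has_derivative_bounded_linear)
  obtain d where d: "d > 0" "\<And>y. norm (y - \<theta>) < d \<Longrightarrow> \<bar>\<phi>' y a - \<phi>' \<theta> a - A (y - \<theta>)\<bar> \<le> e * norm (y - \<theta>)"
    using d2 e unfolding has_derivative_at_alt by (metis real_norm_def)
  obtain r where r: "r > 0" "ball \<theta> r \<subseteq> S"
    using S openE by blast
  \<comment> \<open>For such \<open>t\<close> every point \<open>\<theta> + s a + c b\<close> with
    \<open>s\<close>, \<open>c\<close> in \<open>[0, t]\<close> lies in \<open>S\<close> and within
    the range where the expansion holds.\<close>
  have "\<forall>\<^sub>F t in at_right 0. t \<in> {0<..<min d r / K}"
    using d r K by (intro eventually_at_right_real) simp
  then show "\<forall>\<^sub>F t in at_right 0. dist ((\<phi> (\<theta> + t *\<^sub>R a + t *\<^sub>R b) - \<phi> (\<theta> + t *\<^sub>R a) -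
      \<phi> (\<theta> + t *\<^sub>R b) + \<phi> \<theta>) / t\<^sup>2) (A b) < \<epsilon>"
  proof eventually_elim
    case (elim t)
    then have t: "t > 0" "K * t < d" "K * t < r"
      using K by (auto simp: field_simps)
    have bound: "norm (s *\<^sub>R a + c *\<^sub>R b) \<le> (norm a + norm b) * t" if "s \<in> {0..t}" "c \<in> {0..t}" for s c
    proof -
      have "norm (s *\<^sub>R a + c *\<^sub>R b) \<le> s * norm a + c * norm b"
        using that by (intro order_trans[OF norm_triangle_ineq]) simp
      also have "\<dots> \<le> t * norm a + t * norm b"
        using that by (intro add_mono mult_right_mono) auto
      finally show ?thesis by (simp add: algebra_simps)
    qed
    have "(norm a + norm b) * t \<le> K * t"
      using t by (intro mult_right_mono) (auto simp: K_def)
    with t have close: "norm (s *\<^sub>R a + c *\<^sub>R b) < d" "norm (s *\<^sub>R a + c *\<^sub>R b) < r"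
      if "s \<in> {0..t}" "c \<in> {0..t}" for s c
      using bound[OF that] by linarith+
    define pt where "pt s c = \<theta> + s *\<^sub>R a + c *\<^sub>R b" for s c :: real
    have pt_diff: "pt s c - \<theta> = s *\<^sub>R a + c *\<^sub>R b" for s c
      by (simp add: pt_def algebra_simps)
    have ptS: "pt s c \<in> S" if "s \<in> {0..t}" "c \<in> {0..t}" for s c
    proof -
      have "dist \<theta> (pt s c) = norm (s *\<^sub>R a + c *\<^sub>R b)"
        by (metis dist_norm dist_commute pt_diff)
      with close[OF that] r(2) show ?thesis by auto
    qed
    have deriv: "((\<lambda>s. \<phi> (pt s c)) has_real_derivative \<phi>' (pt s c) a) (at s)"
      if "s \<in> {0..t}" "c \<in> {0..t}" for s c
    proof -
      interpret L: bounded_linear "\<phi>' (pt s c)"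
        using d1[OF ptS[OF that]] by (rule has_derivative_bounded_linear)
      have "((\<lambda>s. pt s c) has_derivative (\<lambda>h. h *\<^sub>R a)) (at s)"
        unfolding pt_def by (auto intro!: derivative_eq_intros)
      from has_derivative_compose[OF this d1[OF ptS[OF that]]]
      have "((\<lambda>s. \<phi> (pt s c)) has_derivative (\<lambda>h. \<phi>' (pt s c) a * h)) (at s)"
        by (simp add: L.scaleR mult.commute[of _ "\<phi>' (pt s c) a"])
      then show ?thesis
        by (simp only: has_field_derivative_def)
    qed
    \<comment> \<open>The increment of \<open>\<psi>\<close> from 0 to \<open>t\<close> is the
      second difference. Applying the mean value theorem to \<open>\<psi>\<close> as a whole gives
      one intermediate point \<open>z\<close> for both first derivatives.\<close>
    define \<psi> where "\<psi> s = \<phi> (pt s t) - \<phi> (pt s 0)" for s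
    have "\<exists>z>0. z < t \<and> \<psi> t - \<psi> 0 = (t - 0) * (\<phi>' (pt z t) a - \<phi>' (pt z 0) a)"
      unfolding \<psi>_def using t by (intro MVT2) (auto intro!: derivative_intros deriv)
    then obtain z where z: "0 < z" "z < t" and
      mvt: "\<psi> t - \<psi> 0 = t * (\<phi>' (pt z t) a - \<phi>' (pt z 0) a)"
      by auto
    have est: "\<bar>\<phi>' (pt z c) a - \<phi>' \<theta> a - A (z *\<^sub>R a + c *\<^sub>R b)\<bar> \<le> e * ((norm a + norm b) * t)"
      if "c \<in> {0..t}" for c
    proof -
      have "\<bar>\<phi>' (pt z c) a - \<phi>' \<theta> a - A (z *\<^sub>R a + c *\<^sub>R b)\<bar> \<le> e * norm (z *\<^sub>R a + c *\<^sub>R b)"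
        using d(2)[of "pt z c"] close[of z c] that z unfolding pt_diff by simp
      also have "\<dots> \<le> e * ((norm a + norm b) * t)"
        using e z that by (intro mult_left_mono bound) auto
      finally show ?thesis .
    qed
    \<comment> \<open>The unknown \<open>z\<close> cancels by linearity of \<open>A\<close>.\<close>
    have "A (z *\<^sub>R a + t *\<^sub>R b) - A (z *\<^sub>R a + 0 *\<^sub>R b) = t * A b"
      by (simp add: A.add A.scaleR)
    then have "\<bar>(\<phi>' (pt z t) a - \<phi>' (pt z 0) a) - t * A b\<bar> \<le> 2 * (e * ((norm a + norm b) * t))"
      using est[of t] est[of 0] t by (simp only: abs_le_iff atLeastAtMost_iff) linarith
    also have "\<dots> \<le> e * K * t"
      using e t by (simp add: K_def algebra_simps)
    finally have "\<bar>(\<phi>' (pt z t) a - \<phi>' (pt z 0) a) - t * A b\<bar> \<le> e * K * t" .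
    then have "t * \<bar>(\<phi>' (pt z t) a - \<phi>' (pt z 0) a) - t * A b\<bar> \<le> t * (e * K * t)"
      using t by (intro mult_left_mono) auto
    moreover have "t * \<bar>(\<phi>' (pt z t) a - \<phi>' (pt z 0) a) - t * A b\<bar> = \<bar>\<psi> t - \<psi> 0 - t\<^sup>2 * A b\<bar>"
    proof -
      have "\<psi> t - \<psi> 0 - t\<^sup>2 * A b = t * ((\<phi>' (pt z t) a - \<phi>' (pt z 0) a) - t * A b)"
        unfolding mvt by (simp add: algebra_simps power2_eq_square)
      then show ?thesis using t by (simp add: abs_mult)
    qed
    ultimately have "\<bar>\<psi> t - \<psi> 0 - t\<^sup>2 * A b\<bar> \<le> (e * K) * t\<^sup>2"
      by (simp add: power2_eq_square algebra_simps)
    also have "\<dots> < \<epsilon> * t\<^sup>2"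
      using t K \<open>\<epsilon> > 0\<close> by (simp add: e_def)
    finally have "\<bar>\<psi> t - \<psi> 0 - t\<^sup>2 * A b\<bar> / t\<^sup>2 < \<epsilon>"
      using t by (simp add: field_simps)
    moreover have "\<bar>\<psi> t - \<psi> 0 - t\<^sup>2 * A b\<bar> / t\<^sup>2 = \<bar>(\<psi> t - \<psi> 0) / t\<^sup>2 - A b\<bar>"
    proof -
      have "(\<psi> t - \<psi> 0) / t\<^sup>2 - A b = (\<psi> t - \<psi> 0 - t\<^sup>2 * A b) / t\<^sup>2"
        using t by (simp add: field_simps)
      then show ?thesis by simp
    qed
    moreover have "\<psi> t - \<psi> 0 = \<phi> (\<theta> + t *\<^sub>R a + t *\<^sub>R b) - \<phi> (\<theta> + t *\<^sub>R a) - \<phi> (\<theta> + t *\<^sub>R b) + \<phi> \<theta>"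
      by (simp add: \<psi>_def pt_def)
    ultimately show ?case by (simp add: dist_real_def)
  qed
qed

text \<open>The second difference is symmetric in \<open>a\<close> and \<open>b\<close>, so both
  mixed derivatives are its limit.\<close>

lemma second_derivative_symmetric:
  fixes \<phi> :: "'a::real_normed_vector \<Rightarrow> real"
  assumes "open S" "\<theta> \<in> S"
    and "\<And>y. y \<in> S \<Longrightarrow> (\<phi> has_derivative \<phi>' y) (at y)"
    and "((\<lambda>y. \<phi>' y a) has_derivative A) (at \<theta>)"
    and "((\<lambda>y. \<phi>' y b) has_derivative B) (at \<theta>)"
  shows "A b = B a"
proof -
  have "((\<lambda>t. (\<phi> (\<theta> + t *\<^sub>R a + t *\<^sub>R b) - \<phi> (\<theta> + t *\<^sub>R a) - \<phi> (\<theta> + t *\<^sub>R b) + \<phi> \<theta>) / t\<^sup>2)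
      \<longlongrightarrow> B a) (at_right 0)"
    using second_difference_tendsto[OF assms(1,2,3,5), of a] by (simp add: algebra_simps)
  with second_difference_tendsto[OF assms(1,2,3,4), of b] show ?thesis
    by (intro tendsto_unique[OF trivial_limit_at_right_real])
qed

text \<open>Testing against the difference itself suffices. This is the way back from scalar
  identities \<open><g, .>\<close> to identities in L2.\<close>

lemma L2_AE_eqI:
  assumes "u \<in> L2 M" "w \<in> L2 M" "\<And>g. g \<in> L2 M \<Longrightarrow> L2_inner M g u = L2_inner M g w"
  shows "AE x in M. u x = w x"
proof -
  have d: "(\<lambda>x. u x - w x) \<in> L2 M"
    using assms by (intro L2_diff)
  then have "L2_inner M (\<lambda>x. u x - w x) (\<lambda>x. u x - w x) = 0"
    using assms by (simp add: L2_inner_diff_right)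
  then show ?thesis
    using d by (simp add: L2_inner_self_eq_0_iff)
qed

text \<open>A fixed witness for Frechet differentiability, with the newest direction at the head of
  the list. The radius may depend on \<open>vs\<close> here, a weaker form of the operator-norm
  estimate in the definition.\<close>

locale L2_derivative_tower =
  fixes k :: nat and M :: "'x measure" and S :: "(real^'n) set"
    and F :: "real^'n \<Rightarrow> 'x \<Rightarrow> real" and D :: "real^'n \<Rightarrow> (real^'n) list \<Rightarrow> 'x \<Rightarrow> real"
  assumes open_S: "open S"
    and D_Nil: "\<theta> \<in> S \<Longrightarrow> D \<theta> [] = F \<theta>"
    and D_multilinear: "j \<le> k \<Longrightarrow> \<theta> \<in> S \<Longrightarrow> L2_multilinear M j (D \<theta>)"
    and D_frechet: "length vs < k \<Longrightarrow> \<theta> \<in> S \<Longrightarrow> 0 < \<epsilon> \<Longrightarrow> \<exists>\<delta>>0. \<forall>h. norm h < \<delta> \<and> \<theta> + h \<in> S \<longrightarrow>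
        L2_norm M (\<lambda>x. D (\<theta> + h) vs x - D \<theta> vs x - D \<theta> (h # vs) x) \<le> \<epsilon> * norm h * prod_list (map norm vs)"
begin

lemma D_L2: "length vs \<le> k \<Longrightarrow> \<theta> \<in> S \<Longrightarrow> D \<theta> vs \<in> L2 M"
  using D_multilinear[of "length vs" \<theta>] by (auto simp: L2_multilinear_def)

lemma D_head_affine:
  assumes "length vs < k" "\<theta> \<in> S"
  shows "AE x in M. D \<theta> ((c *\<^sub>R u + w) # vs) x = c * D \<theta> (u # vs) x + D \<theta> (w # vs) x"
proof -
  have "L2_multilinear M (Suc (length vs)) (D \<theta>)"
    using assms by (intro D_multilinear) auto
  then have "length us + 1 + length ws = Suc (length vs) \<Longrightarrow>
      AE x in M. D \<theta> (us @ (c *\<^sub>R u + w) # ws) x = c * D \<theta> (us @ u # ws) x + D \<theta> (us @ w # ws) x" for us ws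
    unfolding L2_multilinear_def by blast
  from this[of "[]" vs] show ?thesis by simp
qed

lemma D_head_scale:
  assumes "length vs < k" "\<theta> \<in> S"
  shows "AE x in M. D \<theta> ((c *\<^sub>R u) # vs) x = c * D \<theta> (u # vs) x"
proof -
  \<comment> \<open>This instance reads \<open>D(0) = D(0) + D(0)\<close>.\<close>
  have "AE x in M. D \<theta> (0 # vs) x = 0"
    using D_head_affine[OF assms, of 1 0 0] by simp
  with D_head_affine[OF assms, of c u 0] show ?thesis
    by eventually_elim simp
qed

lemma D_head_add:
  assumes "length vs < k" "\<theta> \<in> S"
  shows "AE x in M. D \<theta> ((u + w) # vs) x = D \<theta> (u # vs) x + D \<theta> (w # vs) x"
  using D_head_affine[OF assms, of 1 u w] by simp

lemma inner_D_bounded_linear: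
  assumes "length vs < k" "\<theta> \<in> S" "g \<in> L2 M"
  shows "bounded_linear (\<lambda>h. L2_inner M g (D \<theta> (h # vs)))"
proof (subst linear_conv_bounded_linear[symmetric], rule linearI)
  have mem: "D \<theta> (h # vs) \<in> L2 M" for h
    using assms by (intro D_L2) auto
  show "L2_inner M g (D \<theta> ((u + w) # vs)) = L2_inner M g (D \<theta> (u # vs)) + L2_inner M g (D \<theta> (w # vs))"
    for u w
    using L2_inner_cong_AE[OF assms(3,3) mem L2_add[OF mem mem] _ D_head_add[OF assms(1,2)]] mem assms(3)
    by (simp add: L2_inner_add_right)
  show "L2_inner M g (D \<theta> ((c *\<^sub>R u) # vs)) = c *\<^sub>R L2_inner M g (D \<theta> (u # vs))" for c u
    using L2_inner_cong_AE[OF assms(3,3) mem L2_scale[OF mem] _ D_head_scale[OF assms(1,2)]]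
    by (simp add: L2_inner_scale_right)
qed

text \<open>By Cauchy-Schwarz, pairing with a fixed \<open>g\<close> turns the L2 estimate into a
  scalar one, so that ordinary calculus applies to \<open><g, D y vs>\<close>.\<close>

lemma inner_D_has_derivative:
  assumes vs: "length vs < k" and \<theta>: "\<theta> \<in> S" and g: "g \<in> L2 M"
  shows "((\<lambda>y. L2_inner M g (D y vs)) has_derivative (\<lambda>h. L2_inner M g (D \<theta> (h # vs)))) (at \<theta>)"
  unfolding has_derivative_at_alt
proof (intro conjI allI impI)
  show "bounded_linear (\<lambda>h. L2_inner M g (D \<theta> (h # vs)))"
    using assms by (rule inner_D_bounded_linear)
next
  fix e :: real assume "e > 0"
  \<comment> \<open>Dividing the tolerance by \<open>K\<close> absorbs the norms of \<open>g\<close>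
    and \<open>vs\<close>; the summand 1 ensures positivity.\<close>
  define K where "K = L2_norm M g * prod_list (map norm vs) + 1"
  have P: "0 \<le> prod_list (map norm vs)"
    by (rule prod_list_nonneg) auto
  have K: "K > 0"
    using P by (simp add: K_def add_nonneg_pos L2_norm_nonneg)
  obtain \<delta> where \<delta>: "\<delta> > 0" "\<And>h. norm h < \<delta> \<Longrightarrow> \<theta> + h \<in> S \<Longrightarrow>
      L2_norm M (\<lambda>x. D (\<theta> + h) vs x - D \<theta> vs x - D \<theta> (h # vs) x) \<le> e / K * norm h * prod_list (map norm vs)"
    using D_frechet[OF vs \<theta>, of "e / K"] \<open>e > 0\<close> K by auto
  obtain r where r: "r > 0" "ball \<theta> r \<subseteq> S"
    using open_S \<theta> openE by blast
  have "\<bar>L2_inner M g (D y vs) - L2_inner M g (D \<theta> vs) - L2_inner M g (D \<theta> ((y - \<theta>) # vs))\<bar>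
      \<le> e * norm (y - \<theta>)" if y: "norm (y - \<theta>) < min \<delta> r" for y
  proof -
    have yS: "y \<in> S"
      using y r(2) by (auto simp: dist_norm norm_minus_commute)
    have mem: "D y vs \<in> L2 M" "D \<theta> vs \<in> L2 M" "D \<theta> ((y - \<theta>) # vs) \<in> L2 M"
      using vs \<theta> yS by (auto intro!: D_L2)
    let ?r = "\<lambda>x. D y vs x - D \<theta> vs x - D \<theta> ((y - \<theta>) # vs) x"
    have "\<bar>L2_inner M g (D y vs) - L2_inner M g (D \<theta> vs) - L2_inner M g (D \<theta> ((y - \<theta>) # vs))\<bar>
        = \<bar>L2_inner M g ?r\<bar>"
      using mem g by (simp add: L2_inner_diff_right L2_diff)
    also have "\<dots> \<le> L2_norm M g * L2_norm M ?r"
      using mem g by (intro L2_Cauchy_Schwarz L2_diff)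
    also have "\<dots> \<le> L2_norm M g * (e / K * norm (y - \<theta>) * prod_list (map norm vs))"
      using \<delta>(2)[of "y - \<theta>"] y yS by (intro mult_left_mono L2_norm_nonneg) auto
    also have "\<dots> = (L2_norm M g * prod_list (map norm vs) / K) * (e * norm (y - \<theta>))"
      by simp
    also have "\<dots> \<le> 1 * (e * norm (y - \<theta>))"
      using \<open>e > 0\<close> K by (intro mult_right_mono) (auto simp: K_def)
    finally show ?thesis by simp
  qed
  then show "\<exists>d>0. \<forall>y. norm (y - \<theta>) < d \<longrightarrow>
      norm (L2_inner M g (D y vs) - L2_inner M g (D \<theta> vs) - L2_inner M g (D \<theta> ((y - \<theta>) # vs)))
        \<le> e * norm (y - \<theta>)"
    using \<delta>(1) r(1) by (intro exI[of _ "min \<delta> r"]) auto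
qed

text \<open>Scalar symmetry for \<open>y \<mapsto> <g, D y vs>\<close> with arbitrary
  \<open>g\<close>. The bound on the length leaves room for two differentiations.\<close>

lemma D_swap:
  assumes "length vs + 2 \<le> k" "\<theta> \<in> S"
  shows "AE x in M. D \<theta> (a # b # vs) x = D \<theta> (b # a # vs) x"
proof (rule L2_AE_eqI)
  fix g assume g: "g \<in> L2 M"
  show "L2_inner M g (D \<theta> (a # b # vs)) = L2_inner M g (D \<theta> (b # a # vs))"
    using assms g
    by (intro second_derivative_symmetric[OF open_S assms(2), of "\<lambda>y. L2_inner M g (D y vs)"
          "\<lambda>y h. L2_inner M g (D y (h # vs))"] inner_D_has_derivative) auto
qed (use assms in \<open>auto intro!: D_L2\<close>)

text \<open>Uniqueness of the scalar derivative. The agreement is required on all of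
  \<open>S\<close>, not only at \<open>\<theta>\<close>, because it gets differentiated.\<close>

lemma D_Cons_cong:
  assumes "length vs < k" "length ws < k" "\<theta> \<in> S"
    and eq: "\<And>y. y \<in> S \<Longrightarrow> AE x in M. D y vs x = D y ws x"
  shows "AE x in M. D \<theta> (a # vs) x = D \<theta> (a # ws) x"
proof (rule L2_AE_eqI)
  fix g assume g: "g \<in> L2 M"
  have "L2_inner M g (D y ws) = L2_inner M g (D y vs)" if "y \<in> S" for y
    using that assms(1,2) g eq[OF that, THEN AE_symmetric] by (intro L2_inner_cong_AE D_L2) auto
  then have "((\<lambda>y. L2_inner M g (D y vs)) has_derivative (\<lambda>h. L2_inner M g (D \<theta> (h # ws)))) (at \<theta>)"
    using assms g open_S
    by (intro has_derivative_transform_within_open[OF inner_D_has_derivative[of ws]]) auto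
  then have "(\<lambda>h. L2_inner M g (D \<theta> (h # vs))) = (\<lambda>h. L2_inner M g (D \<theta> (h # ws)))"
    using assms g by (intro has_derivative_unique[OF inner_D_has_derivative]) auto
  then show "L2_inner M g (D \<theta> (a # vs)) = L2_inner M g (D \<theta> (a # ws))"
    by metis
qed (use assms in \<open>auto intro!: D_L2\<close>)

text \<open>\<open>D_swap\<close> only exchanges the two outermost directions. If the heads differ,
  both tails are rearranged, by induction and under the outer derivative, to expose the other head
  before a common rest \<open>us\<close>; one swap then joins them. The point stays general in the
  induction for the sake of \<open>D_Cons_cong\<close>.\<close>

lemma D_permute:
  assumes "mset vs = mset ws" "length vs \<le> k" "\<theta> \<in> S"
  shows "AE x in M. D \<theta> vs x = D \<theta> ws x"
  using assms
proof (induction "length vs" arbitrary: vs ws \<theta>)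
  case 0
  then show ?case by simp
next
  case (Suc n)
  then obtain a vs' where vs: "vs = a # vs'" by (cases vs) auto
  obtain b ws' where ws: "ws = b # ws'" using Suc vs by (cases ws) auto
  note len = mset_eq_length[OF Suc.prems(1)]
  have cons: "AE x in M. D \<theta> (c # us) x = D \<theta> (c # us') x"
    if "mset us = mset us'" "length us = n" for c us us'
  proof (rule D_Cons_cong)
    show "length us < k" "length us' < k"
      using that Suc.hyps(2) Suc.prems(2) mset_eq_length[OF that(1)] by auto
    show "AE x in M. D y us x = D y us' x" if "y \<in> S" for y
      using Suc.hyps(1)[of us us' y] \<open>mset us = mset us'\<close> \<open>length us = n\<close> that Suc.hyps(2) Suc.prems(2) by simp
  qed (fact Suc.prems)
  show ?case
  proof (cases "a = b")
    case True
    then show ?thesis using cons[of vs' ws' a] Suc.hyps(2) Suc.prems(1) vs ws by simp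
  next
    case False
    have "add_mset a (mset vs') = add_mset b (mset ws')"
      using Suc.prems(1) vs ws by simp
    then obtain N where N: "mset vs' = add_mset b N" "mset ws' = add_mset a N"
      using False unfolding add_eq_conv_ex by blast
    obtain us where us: "mset us = N" using ex_mset by blast
    have l: "length vs' = n" "length ws' = n" "length us + 2 \<le> k"
    proof -
      show "length vs' = n" "length ws' = n"
        using Suc.hyps(2) len vs ws by simp_all
      have "length vs' = length us + 1"
        using N(1) us by (metis size_mset size_add_mset Suc_eq_plus1)
      then show "length us + 2 \<le> k"
        using Suc.prems(2) vs by simp
    qed
    have "AE x in M. D \<theta> (a # vs') x = D \<theta> (a # b # us) x"
      using N us l by (intro cons) auto
    moreover have "AE x in M. D \<theta> (a # b # us) x = D \<theta> (b # a # us) x"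
      using l Suc.prems by (intro D_swap)
    moreover have "AE x in M. D \<theta> (b # ws') x = D \<theta> (b # a # us) x"
      using N us l by (intro cons) auto
    ultimately show ?thesis
      unfolding vs ws by eventually_elim simp
  qed
qed

end

text \<open>Uniqueness of limits in L2: \<open>norm (p - g)\<close> is at most the sum of the
  distances of the difference quotient to \<open>p\<close> and to \<open>g\<close>, and both tend to
  0. This determines the value chosen by \<open>L2_partial\<close> up to null sets.\<close>

lemma L2_partial_eqI:
  assumes S: "open S" "\<theta> \<in> S" and F: "\<And>y. y \<in> S \<Longrightarrow> F y \<in> L2 M" and g: "g \<in> L2 M"
    and lim: "((\<lambda>t. L2_norm M (\<lambda>x. (F (\<theta> + t *\<^sub>R axis i 1) x - F \<theta> x) / t - g x)) \<longlongrightarrow> 0) (at 0)"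
  shows "L2_partial M i F \<theta> \<in> L2 M" and "AE x in M. L2_partial M i F \<theta> x = g x"
proof -
  let ?q = "\<lambda>t x. (F (\<theta> + t *\<^sub>R axis i 1) x - F \<theta> x) / t"
  define p where "p = L2_partial M i F \<theta>"
  have "p \<in> L2 M \<and> ((\<lambda>t. L2_norm M (\<lambda>x. ?q t x - p x)) \<longlongrightarrow> 0) (at 0)"
    unfolding p_def L2_partial_def by (rule someI[of _ g]) (use g lim in auto)
  then have p: "p \<in> L2 M" and lim': "((\<lambda>t. L2_norm M (\<lambda>x. ?q t x - p x)) \<longlongrightarrow> 0) (at 0)"
    by auto
  have "((\<lambda>t. \<theta> + t *\<^sub>R axis i (1::real)) \<longlongrightarrow> \<theta> + 0 *\<^sub>R axis i 1) (at 0)"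
    by (intro tendsto_intros)
  then have "\<forall>\<^sub>F t in at 0. \<theta> + t *\<^sub>R axis i 1 \<in> S"
    using S by (intro topological_tendstoD) auto
  then have "\<forall>\<^sub>F t in at 0. L2_norm M (\<lambda>x. p x - g x) \<le> L2_norm M (\<lambda>x. ?q t x - g x) + L2_norm M (\<lambda>x. ?q t x - p x)"
  proof eventually_elim
    case (elim t)
    have q: "?q t \<in> L2 M"
      using elim F S by (intro L2_divide L2_diff) auto
    have "L2_norm M (\<lambda>x. p x - g x) = L2_norm M (\<lambda>x. (?q t x - g x) + (-1) * (?q t x - p x))"
      by simp
    also have "\<dots> \<le> L2_norm M (\<lambda>x. ?q t x - g x) + L2_norm M (\<lambda>x. (-1) * (?q t x - p x))"
      using q p g by (intro L2_norm_add_le L2_scale L2_diff)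
    also have "L2_norm M (\<lambda>x. (-1) * (?q t x - p x)) = L2_norm M (\<lambda>x. ?q t x - p x)"
      by (subst L2_norm_scale) simp
    finally show ?case .
  qed
  moreover have "((\<lambda>t. L2_norm M (\<lambda>x. ?q t x - g x) + L2_norm M (\<lambda>x. ?q t x - p x)) \<longlongrightarrow> 0 + 0) (at 0)"
    by (intro tendsto_add lim lim')
  ultimately have "L2_norm M (\<lambda>x. p x - g x) \<le> 0"
    using tendsto_lowerbound[of _ 0 "at (0::real)"] by simp
  then have "L2_norm M (\<lambda>x. p x - g x) = 0"
    using L2_norm_nonneg by (metis order_antisym)
  then have "AE x in M. p x = g x"
    using p g by (simp add: L2_norm_eq_0_iff L2_diff)
  with p show "L2_partial M i F \<theta> \<in> L2 M" "AE x in M. L2_partial M i F \<theta> x = g x"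
    by (auto simp: p_def)
qed

section \<open>Agreement of iterated L2 partial derivatives with the tower\<close>

context L2_derivative_tower
begin

text \<open>The Frechet estimate at \<open>h = t a\<close> combined with homogeneity in the head. An
  arbitrary family \<open>G\<close> of representatives is allowed because iterated partials match
  \<open>D\<close> only almost everywhere.\<close>

lemma D_difference_quotient_tendsto:
  assumes vs: "length vs < k" and \<theta>: "\<theta> \<in> S"
    and G: "\<And>y. y \<in> S \<Longrightarrow> G y \<in> L2 M" "\<And>y. y \<in> S \<Longrightarrow> AE x in M. G y x = D y vs x"
  shows "((\<lambda>t. L2_norm M (\<lambda>x. (G (\<theta> + t *\<^sub>R a) x - G \<theta> x) / t - D \<theta> (a # vs) x)) \<longlongrightarrow> 0) (at 0)"
proof (rule tendstoI)
  fix e :: real assume "e > 0"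
  define K where "K = norm a * prod_list (map norm vs) + 1"
  have "0 \<le> prod_list (map norm vs)"
    by (rule prod_list_nonneg) auto
  then have K: "K > 0" by (simp add: K_def add_nonneg_pos)
  obtain \<delta> where \<delta>: "\<delta> > 0" "\<And>h. norm h < \<delta> \<Longrightarrow> \<theta> + h \<in> S \<Longrightarrow>
      L2_norm M (\<lambda>x. D (\<theta> + h) vs x - D \<theta> vs x - D \<theta> (h # vs) x) \<le> e / K * norm h * prod_list (map norm vs)"
    using D_frechet[OF vs \<theta>, of "e / K"] \<open>e > 0\<close> K by auto
  have lim: "((\<lambda>t. t *\<^sub>R a) \<longlongrightarrow> 0 *\<^sub>R a) (at 0)" "((\<lambda>t. \<theta> + t *\<^sub>R a) \<longlongrightarrow> \<theta> + 0 *\<^sub>R a) (at 0)"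
    by (intro tendsto_intros)+
  have "\<forall>\<^sub>F t in at 0. t *\<^sub>R a \<in> ball 0 \<delta>"
    using lim(1) \<delta>(1) by (intro topological_tendstoD) auto
  moreover have "\<forall>\<^sub>F t in at 0. \<theta> + t *\<^sub>R a \<in> S"
    using lim(2) \<theta> open_S by (intro topological_tendstoD) auto
  moreover have "\<forall>\<^sub>F t in at (0::real). t \<noteq> 0"
    by (simp add: eventually_at_filter)
  ultimately show "\<forall>\<^sub>F t in at 0. dist (L2_norm M (\<lambda>x. (G (\<theta> + t *\<^sub>R a) x - G \<theta> x) / t - D \<theta> (a # vs) x)) 0 < e"
  proof eventually_elim
    case (elim t)
    let ?y = "\<theta> + t *\<^sub>R a"
    have mem: "D ?y vs \<in> L2 M" "D \<theta> vs \<in> L2 M" "D \<theta> (a # vs) \<in> L2 M" "D \<theta> ((t *\<^sub>R a) # vs) \<in> L2 M"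
      using vs \<theta> elim by (auto intro!: D_L2)
    have "AE x in M. (G ?y x - G \<theta> x) / t - D \<theta> (a # vs) x
        = inverse t * (D ?y vs x - D \<theta> vs x - D \<theta> ((t *\<^sub>R a) # vs) x)"
      using G(2)[OF elim(2)] G(2)[OF \<theta>] D_head_scale[OF vs \<theta>, of t a]
      by eventually_elim (use elim(3) in \<open>simp add: field_simps\<close>)
    then have "L2_norm M (\<lambda>x. (G ?y x - G \<theta> x) / t - D \<theta> (a # vs) x)
        = L2_norm M (\<lambda>x. inverse t * (D ?y vs x - D \<theta> vs x - D \<theta> ((t *\<^sub>R a) # vs) x))"
      using mem G(1) elim(2) \<theta> by (intro L2_norm_cong_AE L2_diff L2_scale L2_divide) auto
    also have "\<dots> = inverse \<bar>t\<bar> * L2_norm M (\<lambda>x. D ?y vs x - D \<theta> vs x - D \<theta> ((t *\<^sub>R a) # vs) x)"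
      by (subst L2_norm_scale) simp
    also have "\<dots> \<le> inverse \<bar>t\<bar> * (e / K * norm (t *\<^sub>R a) * prod_list (map norm vs))"
      using \<delta>(2)[of "t *\<^sub>R a"] elim by (intro mult_left_mono) auto
    also have "\<dots> = e * ((norm a * prod_list (map norm vs)) / K)"
      using elim(3) by simp
    also have "\<dots> < e * 1"
      using \<open>e > 0\<close> K by (intro mult_strict_left_mono) (auto simp: K_def)
    finally show ?case
      by (simp add: L2_norm_nonneg)
  qed
qed

text \<open>The induction covers all points of \<open>S\<close>, since each new partial derivative
  compares neighbouring points. Membership and equality go together because both feed the next
  step.\<close>

lemma L2_partials_eq_D:
  assumes "length is \<le> k" "\<theta> \<in> S"
  shows "L2_partials M is F \<theta> \<in> L2 M \<and> (AE x in M. L2_partials M is F \<theta> x = D \<theta> (map (\<lambda>i. axis i 1) is) x)"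
  using assms
proof (induction "is" arbitrary: \<theta>)
  case Nil
  then show ?case using D_L2[of "[]" \<theta>] D_Nil[of \<theta>] by simp
next
  case (Cons i "is")
  let ?vs = "map (\<lambda>i. axis i (1::real)) is"
  have IH: "L2_partials M is F y \<in> L2 M" "AE x in M. L2_partials M is F y x = D y ?vs x" if "y \<in> S" for y
    using Cons that by auto
  have "((\<lambda>t. L2_norm M (\<lambda>x. (L2_partials M is F (\<theta> + t *\<^sub>R axis i 1) x - L2_partials M is F \<theta> x) / t
      - D \<theta> (axis i 1 # ?vs) x)) \<longlongrightarrow> 0) (at 0)"
    using Cons.prems IH by (intro D_difference_quotient_tendsto) auto
  moreover have "D \<theta> (axis i 1 # ?vs) \<in> L2 M"
    using Cons.prems by (intro D_L2) auto
  ultimately show ?case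
    using L2_partial_eqI[OF open_S Cons.prems(2), of "L2_partials M is F" M "D \<theta> (axis i 1 # ?vs)" i] IH
    by simp
qed

lemma L2_partials_L2: "length is \<le> k \<Longrightarrow> \<theta> \<in> S \<Longrightarrow> L2_partials M is F \<theta> \<in> L2 M"
  using L2_partials_eq_D by blast

text \<open>Needed to compare arbitrary index lists, which occur in \<open>L2_dir_deriv\<close>,
  with the sorted ones that define \<open>eta\<close>.\<close>

lemma L2_partials_permute:
  assumes "mset is = mset js" "length is \<le> k" "\<theta> \<in> S"
  shows "AE x in M. L2_partials M is F \<theta> x = L2_partials M js F \<theta> x"
proof -
  have js: "length js \<le> k"
    using assms mset_eq_length[of "is" js] by simp
  have "AE x in M. D \<theta> (map (\<lambda>i. axis i 1) is) x = D \<theta> (map (\<lambda>i. axis i 1) js) x"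
    using assms by (intro D_permute) auto
  with L2_partials_eq_D[OF assms(2,3), THEN conjunct2] L2_partials_eq_D[OF js assms(3), THEN conjunct2]
  show ?thesis by eventually_elim simp
qed

end

lemma L2_frechet_differentiable_tower:
  fixes S :: "(real^'n) set"
  assumes "L2_frechet_differentiable k M S F" "open S"
  obtains D where "L2_derivative_tower k M S F D"
proof -
  obtain D where D: "\<forall>\<theta>\<in>S. D \<theta> [] = F \<theta>" "\<forall>j\<le>k. \<forall>\<theta>\<in>S. L2_multilinear M j (D \<theta>)"
    "\<forall>j<k. \<forall>\<theta>\<in>S. \<forall>\<epsilon>>0. \<exists>\<delta>>0. \<forall>h. norm h < \<delta> \<and> \<theta> + h \<in> S \<longrightarrow>
           (\<forall>vs. length vs = j \<longrightarrow>
              L2_norm M (\<lambda>x. D (\<theta> + h) vs x - D \<theta> vs x - D \<theta> (h # vs) x)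
                \<le> \<epsilon> * norm h * prod_list (map norm vs))"
    using assms(1) unfolding L2_frechet_differentiable_def by (elim exE conjE) (rule that)
  have "L2_derivative_tower k M S F D"
  proof
    fix vs :: "(real^'n) list" and \<theta> and \<epsilon> :: real assume vs: "length vs < k" and *: "\<theta> \<in> S" "0 < \<epsilon>"
    from D(3)[rule_format, OF vs *]
    show "\<exists>\<delta>>0. \<forall>h. norm h < \<delta> \<and> \<theta> + h \<in> S \<longrightarrow>
        L2_norm M (\<lambda>x. D (\<theta> + h) vs x - D \<theta> vs x - D \<theta> (h # vs) x) \<le> \<epsilon> * norm h * prod_list (map norm vs)"
      by (elim ex_forward conj_forward) auto
  qed (use D assms(2) in auto)
  then show ?thesis by (rule that)
qed

section \<open>Multi-indices as multisets of coordinates, and linear independence of the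
  jets\<close>

section \<open>Multi-indices and jets\<close>

lemma mset_mi_list: "mset (mi_list \<alpha>) = (\<Sum>i\<in>UNIV. replicate_mset (\<alpha> i) i)"
  by (simp add: mi_list_def mset_concat sum_list_distinct_conv_sum_set comp_def)

text \<open>Hence \<open>count (mset is)\<close> serves as the multi-index of an arbitrary index
  list \<open>is\<close>.\<close>

lemma count_mi_list: "count (mset (mi_list \<alpha>)) = \<alpha>"
  by (rule ext) (simp add: mset_mi_list count_sum)

lemma length_mi_list: "length (mi_list \<alpha>) = mi_order \<alpha>"
  by (simp flip: size_mset add: mset_mi_list mi_order_def)

lemma mi_order_count:
  fixes "is" :: "'n::{finite,linorder} list"
  shows "mi_order (count (mset is)) = length is"
proof -
  have "mset (mi_list (count (mset is))) = mset is"
    by (rule multiset_eqI) (simp only: count_mi_list)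
  from mset_eq_length[OF this] show ?thesis
    by (simp add: length_mi_list)
qed

lemma finite_multi_indices: "finite (multi_indices k :: ('n::finite \<Rightarrow> nat) set)"
proof (rule finite_subset)
  show "multi_indices k \<subseteq> (UNIV :: 'n set) \<rightarrow>\<^sub>E {..k}"
  proof
    fix \<alpha> :: "'n \<Rightarrow> nat" assume "\<alpha> \<in> multi_indices k"
    then have "\<alpha> i \<le> k" for i
      using member_le_sum[of i UNIV \<alpha>] by (simp add: multi_indices_def mi_order_def)
    then show "\<alpha> \<in> UNIV \<rightarrow>\<^sub>E {..k}" by auto
  qed
qed (intro finite_PiE; simp)

lemma jet_space_eq_span: "jet_space M f \<theta> m = L2_span M (multi_indices m) (eta M f \<theta>)"
  by (simp add: jet_space_def L2_span_def)

lemma quadratic_form_L2_inner: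
  assumes "\<And>p. u p \<in> L2 M"
  shows "v \<bullet> ((\<chi> p q. L2_inner M (u p) (u q)) *v v)
    = L2_inner M (\<lambda>x. \<Sum>p\<in>UNIV. v $ p * u p x) (\<lambda>x. \<Sum>p\<in>UNIV. v $ p * u p x)"
  using assms
  by (simp add: inner_vec_def matrix_vector_mult_def L2_inner_lincomb_left L2_inner_lincomb_right
      L2_lincomb mult.commute)

text \<open>The Gram form at \<open>c\<close> is the squared norm of the combination with
  coefficients \<open>c\<close>.\<close>

lemma gram_pos_def_independent:
  assumes "gram_pos_def M f \<theta> k" and eta: "\<And>\<alpha>. \<alpha> \<in> multi_indices k \<Longrightarrow> eta M f \<theta> \<alpha> \<in> L2 M"
    and zero: "AE x in M. (\<Sum>\<alpha>\<in>multi_indices k. c \<alpha> * eta M f \<theta> \<alpha> x) = 0"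
    and \<alpha>: "\<alpha> \<in> multi_indices k"
  shows "c \<alpha> = 0"
proof (rule ccontr)
  let ?u = "\<lambda>x. \<Sum>\<alpha>\<in>multi_indices k. c \<alpha> * eta M f \<theta> \<alpha> x"
  assume "c \<alpha> \<noteq> 0"
  then have "0 < (\<Sum>\<alpha>\<in>multi_indices k. \<Sum>\<beta>\<in>multi_indices k.
      c \<alpha> * c \<beta> * L2_inner M (eta M f \<theta> \<alpha>) (eta M f \<theta> \<beta>))"
    using assms(1) \<alpha> unfolding gram_pos_def_def by blast
  also have "\<dots> = L2_inner M ?u ?u"
    using eta by (simp add: L2_inner_lincomb_left L2_inner_lincomb_right L2_lincomb sum_distrib_left mult.assoc)
  also have "\<dots> = 0"
    using zero eta by (simp add: L2_inner_self_eq_0_iff L2_lincomb)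
  finally show False by simp
qed

text \<open>A pure power arises from one list only, so its coefficient in a directional derivative
  is the single monomial \<open>w $ i ^ k\<close>.\<close>

lemma lists_with_count_single:
  "{is. length is = k \<and> count (mset is) = (\<lambda>j. if j = i then k else 0)} = {replicate k i}"
proof -
  have "is = replicate k i" if "length is = k" "count (mset is) = (\<lambda>j. if j = i then k else 0)" for "is"
  proof -
    have "x = i" if "x \<in> set is" for x
    proof (rule ccontr)
      assume "x \<noteq> i"
      then have "count (mset is) x = 0" using \<open>count (mset is) = _\<close> by simp
      then show False using \<open>x \<in> set is\<close> by (simp add: count_eq_zero_iff)
    qed
    with \<open>length is = k\<close> show ?thesis by (metis replicate_length_same)
  qed
  moreover have "count (mset (replicate k i)) = (\<lambda>j. if j = i then k else 0)"
    by auto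
  ultimately show ?thesis by auto
qed

lemma finite_lists_of_length: "finite {is :: 'n::finite list. length is = k}"
  using finite_lists_length_eq[of "UNIV :: 'n set" k] by simp

text \<open>A tower on \<open>S\<close> together with the Gram condition at the one point
  \<open>\<theta>\<close>.\<close>

locale regular_jets =
  L2_derivative_tower k M S "sqrt_embedding f" D
  for k :: nat and M :: "'x measure" and S :: "(real^'n::{finite,linorder}) set"
    and f :: "real^'n::{finite,linorder} \<Rightarrow> 'x \<Rightarrow> real" and D +
  fixes \<theta> :: "real^'n::{finite,linorder}"
  assumes \<theta>_in_S: "\<theta> \<in> S" and gram: "gram_pos_def M f \<theta> k"
begin

lemma eta_L2: "mi_order \<alpha> \<le> k \<Longrightarrow> eta M f \<theta> \<alpha> \<in> L2 M"
  unfolding eta_def using \<theta>_in_S by (intro L2_partials_L2) (simp add: length_mi_list)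

lemma L2_dir_deriv_L2: "j \<le> k \<Longrightarrow> L2_dir_deriv M j w (sqrt_embedding f) \<theta> \<in> L2 M"
  unfolding L2_dir_deriv_def using \<theta>_in_S by (intro L2_lincomb L2_partials_L2) auto

text \<open>The multinomial expansion with its coefficients left as sums over lists: index lists are
  grouped by their multi-index, which symmetry of the derivatives permits.\<close>

lemma L2_dir_deriv_eq_eta_sum:
  assumes "j \<le> k"
  shows "AE x in M. L2_dir_deriv M j w (sqrt_embedding f) \<theta> x
    = (\<Sum>\<alpha> | mi_order \<alpha> = j.
        (\<Sum>is | length is = j \<and> count (mset is) = \<alpha>. prod_list (map (($) w) is)) * eta M f \<theta> \<alpha> x)"
proof -
  let ?L = "{is :: 'n list. length is = j}" and ?A = "{\<alpha> :: 'n \<Rightarrow> nat. mi_order \<alpha> = j}"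
  have "finite ?A"
  \<comment> \<open>Order 0 is separate because \<open>multi_indices\<close> starts at order
    1.\<close>
  proof (cases "j = 0")
    case True
    then have "?A = {\<lambda>_. 0}" by (auto simp: mi_order_def)
    then show ?thesis by simp
  next
    case False
    then show ?thesis
      by (intro finite_subset[OF _ finite_multi_indices[of j]]) (auto simp: multi_indices_def)
  qed
  have "\<forall>is\<in>?L. AE x in M. L2_partials M is (sqrt_embedding f) \<theta> x = eta M f \<theta> (count (mset is)) x"
    unfolding eta_def using assms \<theta>_in_S
    by (auto intro!: L2_partials_permute multiset_eqI simp: count_mi_list)
  \<comment> \<open>There are finitely many lists, so their exceptional null sets can be
    combined.\<close>
  then have "AE x in M. \<forall>is\<in>?L. L2_partials M is (sqrt_embedding f) \<theta> x = eta M f \<theta> (count (mset is)) x"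
    by (intro eventually_ball_finite finite_lists_of_length)
  then show ?thesis
  proof eventually_elim
    case (elim x)
    have "L2_dir_deriv M j w (sqrt_embedding f) \<theta> x
        = (\<Sum>is\<in>?L. prod_list (map (($) w) is) * eta M f \<theta> (count (mset is)) x)"
      unfolding L2_dir_deriv_def using elim by (intro sum.cong) auto
    also have "\<dots> = (\<Sum>\<alpha>\<in>?A. \<Sum>is | is \<in> ?L \<and> count (mset is) = \<alpha>.
        prod_list (map (($) w) is) * eta M f \<theta> (count (mset is)) x)"
      using \<open>finite ?A\<close> by (intro sum.group[symmetric] finite_lists_of_length) (auto simp: mi_order_count)
    also have "\<dots> = (\<Sum>\<alpha>\<in>?A.
        (\<Sum>is | length is = j \<and> count (mset is) = \<alpha>. prod_list (map (($) w) is)) * eta M f \<theta> \<alpha> x)"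
      by (intro sum.cong refl) (simp add: sum_distrib_right)
    finally show ?case .
  qed
qed

text \<open>Membership would be a linear relation among the \<open>eta\<close> of order at most
  \<open>k\<close>. Independence kills every coefficient, in particular \<open>w $ i ^ j\<close> at
  the pure derivative of order \<open>j\<close> in direction \<open>i\<close>.\<close>

lemma dir_deriv_in_jet_space_imp_zero:
  assumes j: "1 \<le> j" "j \<le> k"
    and mem: "L2_dir_deriv M j w (sqrt_embedding f) \<theta> \<in> jet_space M f \<theta> (j - 1)"
  shows "w = 0"
proof -
  have "w $ i = 0" for i
  proof -
    define c where "c \<alpha> = (\<Sum>is | length is = j \<and> count (mset is) = \<alpha>. prod_list (map (($) w) is))"
      for \<alpha> :: "'n \<Rightarrow> nat"
    obtain b where b: "AE x in M. L2_dir_deriv M j w (sqrt_embedding f) \<theta> x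
        = (\<Sum>\<alpha>\<in>multi_indices (j - 1). b \<alpha> * eta M f \<theta> \<alpha> x)"
      using mem by (auto simp: jet_space_def)
    \<comment> \<open>Coefficients of that relation: \<open>c\<close> in order \<open>j\<close>,
      \<open>- b\<close> in lower orders, 0 above \<open>j\<close>.\<close>
    define e where "e \<alpha> = (if mi_order \<alpha> = j then c \<alpha> else 0)
        - (if \<alpha> \<in> multi_indices (j - 1) then b \<alpha> else 0)" for \<alpha>
    have "(\<Sum>\<alpha>\<in>multi_indices k. e \<alpha> * eta M f \<theta> \<alpha> x)
        = (\<Sum>\<alpha> | mi_order \<alpha> = j. c \<alpha> * eta M f \<theta> \<alpha> x)
          - (\<Sum>\<alpha>\<in>multi_indices (j - 1). b \<alpha> * eta M f \<theta> \<alpha> x)" for x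
    proof -
      have "(\<Sum>\<alpha>\<in>multi_indices k. (if mi_order \<alpha> = j then c \<alpha> else 0) * eta M f \<theta> \<alpha> x)
          = (\<Sum>\<alpha> | mi_order \<alpha> = j. c \<alpha> * eta M f \<theta> \<alpha> x)"
        using j by (intro sum.mono_neutral_cong_right finite_multi_indices) (auto simp: multi_indices_def)
      moreover have "(\<Sum>\<alpha>\<in>multi_indices k. (if \<alpha> \<in> multi_indices (j - 1) then b \<alpha> else 0) * eta M f \<theta> \<alpha> x)
          = (\<Sum>\<alpha>\<in>multi_indices (j - 1). b \<alpha> * eta M f \<theta> \<alpha> x)"
        using j by (intro sum.mono_neutral_cong_right finite_multi_indices) (auto simp: multi_indices_def)
      ultimately show ?thesis
        by (simp only: e_def left_diff_distrib sum_subtractf)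
    qed
    moreover have "AE x in M. (\<Sum>\<alpha> | mi_order \<alpha> = j. c \<alpha> * eta M f \<theta> \<alpha> x)
        - (\<Sum>\<alpha>\<in>multi_indices (j - 1). b \<alpha> * eta M f \<theta> \<alpha> x) = 0"
      using b L2_dir_deriv_eq_eta_sum[OF j(2), of w, folded c_def] by eventually_elim simp
    ultimately have zero: "AE x in M. (\<Sum>\<alpha>\<in>multi_indices k. e \<alpha> * eta M f \<theta> \<alpha> x) = 0"
      by simp
    \<comment> \<open>The pure multi-index has order \<open>j\<close>, outside
      \<open>multi_indices (j - 1)\<close>, so \<open>b\<close> does not contribute to its
      coefficient.\<close>
    define \<alpha>0 where "\<alpha>0 = (\<lambda>l. if l = i then j else 0)"
    have ord: "mi_order \<alpha>0 = j" by (simp add: \<alpha>0_def mi_order_def)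
    then have "e \<alpha>0 = 0"
      using j by (intro gram_pos_def_independent[OF gram eta_L2 zero]) (auto simp: multi_indices_def)
    moreover have "e \<alpha>0 = c \<alpha>0"
      using j ord by (auto simp: e_def multi_indices_def)
    moreover have "c \<alpha>0 = (w $ i) ^ j"
      unfolding c_def \<alpha>0_def lists_with_count_single by simp
    ultimately show "w $ i = 0" by simp
  qed
  then show ?thesis by (simp add: vec_eq_iff)
qed

text \<open>The form \<open>w \<bullet> G w\<close> is the squared norm of the first derivative
  along \<open>w\<close>. A kernel vector makes that derivative null, hence a member of the jet
  space of order 0, and the preceding lemma with \<open>j = 1\<close> applies.\<close>

lemma metric_matrix_invertible:
  assumes "1 \<le> k"
  shows "invertible (metric_matrix M f \<theta>)"
proof -
  have "w = 0" if "metric_matrix M f \<theta> *v w = 0" for w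
  proof -
    have mem: "L2_partial M i (sqrt_embedding f) \<theta> \<in> L2 M" for i
      using L2_partials_L2[of "[i]" \<theta>] assms \<theta>_in_S by simp
    have dd: "L2_dir_deriv M 1 w (sqrt_embedding f) \<theta>
        = (\<lambda>x. \<Sum>i\<in>UNIV. w $ i * L2_partial M i (sqrt_embedding f) \<theta> x)"
    proof -
      have "{is :: 'n list. length is = 1} = (\<lambda>i. [i]) ` UNIV"
        by (auto simp: length_Suc_conv)
      then show ?thesis
        by (simp add: L2_dir_deriv_def sum.reindex inj_on_def)
    qed
    have "L2_inner M (L2_dir_deriv M 1 w (sqrt_embedding f) \<theta>) (L2_dir_deriv M 1 w (sqrt_embedding f) \<theta>)
        = w \<bullet> (metric_matrix M f \<theta> *v w)"
      unfolding dd metric_matrix_def by (rule quadratic_form_L2_inner[OF mem, symmetric])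
    then have "AE x in M. L2_dir_deriv M 1 w (sqrt_embedding f) \<theta> x = 0"
      using that L2_inner_self_eq_0_iff[OF L2_dir_deriv_L2[OF assms]] by simp
    \<comment> \<open>The jet space of order 0 therefore consists of the null functions.\<close>
    moreover have "multi_indices 0 = ({} :: ('n \<Rightarrow> nat) set)" by (auto simp: multi_indices_def)
    ultimately have "L2_dir_deriv M 1 w (sqrt_embedding f) \<theta> \<in> jet_space M f \<theta> (1 - 1)"
      using L2_dir_deriv_L2[OF assms] by (simp add: jet_space_def)
    then show "w = 0"
      using assms by (intro dir_deriv_in_jet_space_imp_zero[of 1]) auto
  qed
  then show ?thesis
    by (simp add: invertible_left_inverse matrix_left_invertible_ker)
qed

lemma directional_curvature_complement:
  assumes "m < k"
  shows "directional_curvature M f \<theta> m v \<in> L2_orthogonal_complement M (jet_space M f \<theta> m)"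
  unfolding directional_curvature_def jet_space_eq_span using assms
  by (intro L2_proj_complement_span finite_multi_indices eta_L2 L2_dir_deriv_L2) (auto simp: multi_indices_def)

text \<open>Zero curvature puts the derivative of order \<open>m + 1\<close> into the jet space of
  order \<open>m\<close>, so its direction \<open>w = G^-1 v\<close> vanishes, and
  \<open>v = G w\<close>.\<close>

lemma directional_curvature_zero_imp:
  assumes "m < k" and zero: "AE x in M. directional_curvature M f \<theta> m v x = 0"
  shows "v = 0"
proof -
  let ?w = "matrix_inv (metric_matrix M f \<theta>) *v v"
  let ?d = "L2_dir_deriv M (m + 1) ?w (sqrt_embedding f) \<theta>" and ?V = "jet_space M f \<theta> m"
  have d: "?d \<in> L2 M" using assms by (intro L2_dir_deriv_L2) simp
  have eta: "eta M f \<theta> \<alpha> \<in> L2 M" if "\<alpha> \<in> multi_indices m" for \<alpha>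
    using that assms by (intro eta_L2) (simp add: multi_indices_def)
  have "AE x in M. directional_curvature M f \<theta> m v x = ?d x - L2_proj M ?V ?d x"
    unfolding directional_curvature_def jet_space_eq_span
    using eta d by (intro L2_proj_complement_span finite_multi_indices)
  with zero have eq: "AE x in M. ?d x = L2_proj M ?V ?d x"
    by eventually_elim simp
  have "L2_proj M ?V ?d \<in> ?V"
    unfolding jet_space_eq_span using eta d by (intro L2_proj_span finite_multi_indices)
  then obtain c where "AE x in M. L2_proj M ?V ?d x = (\<Sum>\<alpha>\<in>multi_indices m. c \<alpha> * eta M f \<theta> \<alpha> x)"
    by (auto simp: jet_space_def)
  with eq have "AE x in M. ?d x = (\<Sum>\<alpha>\<in>multi_indices m. c \<alpha> * eta M f \<theta> \<alpha> x)"
    by eventually_elim simp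
  with d have "?d \<in> jet_space M f \<theta> (m + 1 - 1)"
    by (auto simp: jet_space_def)
  then have w: "?w = 0"
    using assms(1) by (intro dir_deriv_in_jet_space_imp_zero[of "m + 1"]) auto
  have "invertible (metric_matrix M f \<theta>)"
    using assms(1) by (intro metric_matrix_invertible) simp
  \<comment> \<open>\<open>matrix_inv\<close> is defined by choice; invertibility makes the choice
    an inverse.\<close>
  from someI_ex[OF this[unfolded invertible_def]]
  have "metric_matrix M f \<theta> ** matrix_inv (metric_matrix M f \<theta>) = mat 1"
    by (simp only: matrix_inv_def)
  then have "v = metric_matrix M f \<theta> *v ?w"
    by (simp add: matrix_vector_mul_assoc)
  then show ?thesis by (simp add: w)
qed

end


section \<open>Estimation errors as elements of L2, and quadratic forms as squared residuals\<close>

section \<open>Lifted errors\<close>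

lemma borel_measurable_vec_component:
  fixes T :: "'x \<Rightarrow> real^'n"
  assumes "T \<in> borel_measurable M"
  shows "(\<lambda>x. T x $ p) \<in> borel_measurable M"
  using borel_measurable_inner[OF assms borel_measurable_const[of "axis p 1"]]
  by (simp add: inner_axis)

text \<open>Multiplication by the square root of the density carries L2 of \<open>P \<theta>\<close>
  into L2 of \<open>M\<close>.\<close>

lemma lifted_error_L2:
  assumes P: "prob_space (P \<theta>)" "P \<theta> = density M (\<lambda>x. ennreal (f \<theta> x))"
    and f: "f \<theta> \<in> borel_measurable M" "\<And>x. x \<in> space M \<Longrightarrow> 0 < f \<theta> x"
    and T: "T \<in> borel_measurable M" "integrable (P \<theta>) (\<lambda>x. (T x $ p)\<^sup>2)"
  shows "lifted_error f T \<theta> p \<in> L2 M"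
proof -
  interpret prob_space "P \<theta>" by fact
  note [measurable] = f(1)
  have Tp [measurable]: "(\<lambda>x. T x $ p) \<in> borel_measurable M"
    using T(1) by (rule borel_measurable_vec_component)
  have "(\<lambda>x. T x $ p) \<in> L2 (P \<theta>)"
    using T(2) by (simp add: L2_def P(2))
  \<comment> \<open>Constants are square-integrable because \<open>P \<theta>\<close> is a
    probability measure.\<close>
  moreover have "(\<lambda>x. \<theta> $ p) \<in> L2 (P \<theta>)"
    by (simp add: L2_def)
  ultimately have "(\<lambda>x. T x $ p - \<theta> $ p) \<in> L2 (P \<theta>)"
    by (rule L2_diff)
  then have "integrable (P \<theta>) (\<lambda>x. (T x $ p - \<theta> $ p)\<^sup>2)"
    by (simp add: L2_def)
  then have "integrable M (\<lambda>x. f \<theta> x * (T x $ p - \<theta> $ p)\<^sup>2)"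
    unfolding P(2) using f by (subst (asm) integrable_density) (auto simp: less_imp_le)
  also have "?this \<longleftrightarrow> integrable M (\<lambda>x. (lifted_error f T \<theta> p x)\<^sup>2)"
    using f(2) by (intro Bochner_Integration.integrable_cong)
      (auto simp: lifted_error_def sqrt_embedding_def power_mult_distrib less_imp_le mult.commute)
  finally show ?thesis
    by (simp add: L2_def lifted_error_def sqrt_embedding_def)
qed

text \<open>The density splits as the product of two square roots, one for each error; the
  covariance becomes a Gram matrix.\<close>

lemma covariance_matrix_eq_L2_inner:
  assumes P: "P \<theta> = density M (\<lambda>x. ennreal (f \<theta> x))"
    and f: "f \<theta> \<in> borel_measurable M" "\<And>x. x \<in> space M \<Longrightarrow> 0 < f \<theta> x"
    and T: "T \<in> borel_measurable M"
  shows "covariance_matrix P T \<theta> = (\<chi> p q. L2_inner M (lifted_error f T \<theta> p) (lifted_error f T \<theta> q))"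
proof -
  have [measurable]: "(\<lambda>x. T x $ p) \<in> borel_measurable M" for p
    using T by (rule borel_measurable_vec_component)
  have "(\<integral>x. (T x $ p - \<theta> $ p) * (T x $ q - \<theta> $ q) \<partial>P \<theta>)
      = (\<integral>x. f \<theta> x * ((T x $ p - \<theta> $ p) * (T x $ q - \<theta> $ q)) \<partial>M)" for p q
    unfolding P using f by (subst integral_density) (auto simp: less_imp_le)
  also have "\<dots> p q = L2_inner M (lifted_error f T \<theta> p) (lifted_error f T \<theta> q)" for p q
    unfolding L2_inner_def
  proof (intro Bochner_Integration.integral_cong refl)
    fix x assume "x \<in> space M"
    then have "f \<theta> x = sqrt (f \<theta> x) * sqrt (f \<theta> x)"
      using f(2) by (simp add: less_imp_le)
    then show "f \<theta> x * ((T x $ p - \<theta> $ p) * (T x $ q - \<theta> $ q))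
        = lifted_error f T \<theta> p x * lifted_error f T \<theta> q x"
      by (simp add: lifted_error_def sqrt_embedding_def)
  qed
  finally show ?thesis
    by (simp add: covariance_matrix_def vec_eq_iff)
qed

text \<open>Projection is linear up to null sets, so the two forms are the squared norms of
  \<open>z\<close> and of its projection; Pythagoras gives their difference.\<close>

lemma quadratic_form_residual:
  fixes u :: "'n::finite \<Rightarrow> 'x \<Rightarrow> real" and v :: "real^'n"
  assumes A: "finite A" "\<And>i. i \<in> A \<Longrightarrow> e i \<in> L2 M" and u: "\<And>p. u p \<in> L2 M"
  defines "V \<equiv> L2_span M A e" and "z \<equiv> \<lambda>x. \<Sum>p\<in>UNIV. v $ p * u p x"
  shows "v \<bullet> (((\<chi> p q. L2_inner M (u p) (u q)) -
        (\<chi> p q. L2_inner M (L2_proj M V (u p)) (L2_proj M V (u q)))) *v v)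
    = L2_inner M (\<lambda>x. z x - L2_proj M V z x) (\<lambda>x. z x - L2_proj M V z x)"
proof -
  have V: "L2_subspace M V" unfolding V_def by (rule L2_subspace_span)
  have proj: "L2_proj M V w \<in> V" "\<And>y. y \<in> V \<Longrightarrow> L2_inner M (\<lambda>x. w x - L2_proj M V w x) y = 0"
    if "w \<in> L2 M" for w
    unfolding V_def using A that by (auto intro!: L2_proj_span)
  have projL2: "L2_proj M V w \<in> L2 M" if "w \<in> L2 M" for w
    using that by (intro L2_subspace_in_L2[OF V proj(1)])
  have z: "z \<in> L2 M" unfolding z_def using u by (intro L2_lincomb)
  let ?y = "\<lambda>x. \<Sum>p\<in>UNIV. v $ p * L2_proj M V (u p) x" and ?pz = "L2_proj M V z"
  have y: "?y \<in> V"
    by (intro L2_subspace_lincomb[OF V] proj(1) u)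
  have y_orth: "L2_inner M (\<lambda>x. z x - ?y x) w = 0" if "w \<in> V" for w
  proof -
    have "(\<lambda>x. z x - ?y x) = (\<lambda>x. \<Sum>p\<in>UNIV. v $ p * (u p x - L2_proj M V (u p) x))"
      by (simp add: z_def right_diff_distrib sum_subtractf)
    then show ?thesis
      using that u proj(2) projL2 L2_subspace_in_L2[OF V that]
      by (simp add: L2_inner_lincomb_left L2_diff)
  qed
  \<comment> \<open>The chosen representatives need not depend linearly on their argument, so
    uniqueness of projections is used.\<close>
  have y_eq: "AE x in M. ?y x = ?pz x"
    using y_orth proj[OF z] by (intro L2_proj_unique[OF V z y]) auto
  have pz: "?pz \<in> V" "L2_inner M (\<lambda>x. z x - ?pz x) ?pz = 0"
    using proj[OF z] by auto
  have "v \<bullet> (((\<chi> p q. L2_inner M (u p) (u q)) -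
        (\<chi> p q. L2_inner M (L2_proj M V (u p)) (L2_proj M V (u q)))) *v v)
      = L2_inner M z z - L2_inner M ?y ?y"
    using u projL2 by (simp add: matrix_vector_mult_diff_rdistrib inner_diff_right quadratic_form_L2_inner z_def)
  also have "L2_inner M ?y ?y = L2_inner M ?pz ?pz"
    using y_eq L2_subspace_in_L2[OF V y] projL2[OF z] by (intro L2_inner_cong_AE)
  also have "L2_inner M z z - L2_inner M ?pz ?pz = L2_inner M (\<lambda>x. z x - ?pz x) (\<lambda>x. z x - ?pz x)"
    using pz(2) z projL2[OF z]
    by (simp add: L2_inner_diff_left L2_inner_diff_right L2_diff L2_inner_commute[of M ?pz z])
  finally show ?thesis .
qed

section \<open>The curvature bound for the covariance and its equality case\<close>

theorem theorem9:
  fixes M :: "'x measure"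
    and \<Theta> :: "(real^'n::{finite,linorder}) set"
    and P :: "real^'n::{finite,linorder} \<Rightarrow> 'x measure"
    and f :: "real^'n::{finite,linorder} \<Rightarrow> 'x \<Rightarrow> real"
    and T :: "'x \<Rightarrow> real^'n::{finite,linorder}"
    and \<theta> v :: "real^'n::{finite,linorder}"
    and m :: nat
  assumes "sigma_finite_measure M"
    and "open \<Theta>"
    and "\<And>\<theta>'. \<theta>' \<in> \<Theta> \<Longrightarrow> prob_space (P \<theta>')"
    and "\<And>\<theta>'. \<theta>' \<in> \<Theta> \<Longrightarrow> f \<theta>' \<in> borel_measurable M"
    and "\<And>\<theta>' x. \<theta>' \<in> \<Theta> \<Longrightarrow> x \<in> space M \<Longrightarrow> 0 < f \<theta>' x"
    and "\<And>\<theta>'. \<theta>' \<in> \<Theta> \<Longrightarrow> P \<theta>' = density M (\<lambda>x. ennreal (f \<theta>' x))"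
    and "1 \<le> m"
    and "\<theta> \<in> \<Theta>"
    and "regular_of_order (m + 1) M \<Theta> P f \<theta>"
    and "T \<in> borel_measurable M"
    and "\<And>\<theta>' p. \<theta>' \<in> \<Theta> \<Longrightarrow> integrable (P \<theta>') (\<lambda>x. (T x $ p)\<^sup>2)"
    and "\<And>\<theta>'. \<theta>' \<in> \<Theta> \<Longrightarrow> (\<integral>x. T x \<partial>P \<theta>') = \<theta>'"
  shows "let Q = v \<bullet> ((covariance_matrix P T \<theta> - bhattacharyya_matrix M f T \<theta> m) *v v);
             Z = lifted_error_dir f T \<theta> v;
             N = (\<lambda>x. Z x - L2_proj M (jet_space M f \<theta> m) Z x);
             C = directional_curvature M f \<theta> m v;
             R = (if AE x in M. C x = 0 then 0 else (L2_inner M Z C)\<^sup>2 / (L2_norm M C)\<^sup>2)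
         in Q \<ge> R \<and> (Q = R \<longleftrightarrow> L2_collinear M N C)"
proof -
  let ?V = "jet_space M f \<theta> m"
  define Z where "Z = lifted_error_dir f T \<theta> v"
  define N where "N = (\<lambda>x. Z x - L2_proj M ?V Z x)"
  define C where "C = directional_curvature M f \<theta> m v"
  define Q where "Q = v \<bullet> ((covariance_matrix P T \<theta> - bhattacharyya_matrix M f T \<theta> m) *v v)"
  obtain D where tower: "L2_derivative_tower (m + 1) M \<Theta> (sqrt_embedding f) D"
    using assms(2,9) by (auto simp: regular_of_order_def elim: L2_frechet_differentiable_tower)
  interpret regular_jets "m + 1" M \<Theta> f D \<theta>
    using tower assms(8,9) by (simp add: regular_jets_def regular_jets_axioms_def regular_of_order_def)
  have eta: "eta M f \<theta> \<alpha> \<in> L2 M" if "\<alpha> \<in> multi_indices m" for \<alpha>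
    using that by (intro eta_L2) (simp add: multi_indices_def)
  have err: "lifted_error f T \<theta> p \<in> L2 M" for p
    using assms by (intro lifted_error_L2[of P]) auto
  have Z: "Z \<in> L2 M"
    unfolding Z_def lifted_error_dir_def using err by (intro L2_lincomb)
  have pZ: "L2_proj M ?V Z \<in> ?V"
    unfolding jet_space_eq_span using eta Z by (intro L2_proj_span finite_multi_indices)
  then have pZ_L2: "L2_proj M ?V Z \<in> L2 M" by (simp add: jet_space_def)
  then have N: "N \<in> L2 M" unfolding N_def using Z by (intro L2_diff)
  have C: "C \<in> L2 M" "\<And>w. w \<in> ?V \<Longrightarrow> L2_inner M C w = 0"
    using directional_curvature_complement[of m v] by (auto simp: C_def L2_orthogonal_complement_def)
  have Q: "Q = L2_inner M N N"
    unfolding Q_def N_def Z_def lifted_error_dir_def bhattacharyya_matrix_def jet_space_eq_span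
    using assms eta err
    by (subst covariance_matrix_eq_L2_inner) (auto intro!: quadratic_form_residual finite_multi_indices)
  \<comment> \<open>The projected part of \<open>Z\<close> lies in the jet space, to which
    \<open>C\<close> is orthogonal.\<close>
  have NC: "L2_inner M N C = L2_inner M Z C"
    using C(2)[OF pZ] Z pZ_L2 C(1)
    by (simp add: N_def L2_inner_diff_left L2_inner_commute[of M "L2_proj M ?V Z"])
  define R where "R = (if AE x in M. C x = 0 then 0 else (L2_inner M Z C)\<^sup>2 / (L2_norm M C)\<^sup>2)"
  have "R \<le> Q \<and> (Q = R \<longleftrightarrow> L2_collinear M N C)"
  proof (cases "AE x in M. C x = 0")
    case True
    \<comment> \<open>For null \<open>C\<close> collinearity is automatic and \<open>R = 0\<close>,
      so the equivalence demands \<open>Q = 0\<close>.\<close>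
    have "v = 0"
      using True by (intro directional_curvature_zero_imp[of m]) (auto simp: C_def)
    then have "Q = 0" by (simp add: Q_def)
    moreover have "AE x in M. 0 * N x + 1 * C x = 0" using True by simp
    then have "L2_collinear M N C"
      unfolding L2_collinear_def by (metis zero_neq_one)
    ultimately show ?thesis using True by (simp add: R_def)
  next
    case False
    then have R: "R = (L2_inner M N C)\<^sup>2 / L2_inner M C C"
      by (simp add: R_def NC L2_norm_square)
    have "L2_inner M C C \<noteq> 0"
      using False C(1) by (simp add: L2_inner_self_eq_0_iff)
    then have "0 < L2_inner M C C"
      using L2_inner_self_nonneg[of M C] by simp
    then have "R \<le> Q"
      using L2_Cauchy_Schwarz_square[OF N C(1)] by (simp add: R Q pos_divide_le_eq)
    then show ?thesis
      using L2_Cauchy_Schwarz_collinear_iff[OF N C(1) False] by (simp add: R Q)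
  qed
  then show ?thesis
    unfolding Let_def Q_def R_def N_def C_def Z_def .
qed

end
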